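(* Let $A_1,\dots,A_k$ be $2\times2$ real matrices with all entries strictly positive and norm $<1$, $d_i\in\mathbb R^2$, $T_i(x)=A_ix+d_i$, with $T_i(D)\subset D$ for all $i$ ($D$ the closed unit disc). Let $\mu$ be a Bernoulli measure on $\Sigma=\{1,\dots,k\}^{\mathbb N}$, fix $\theta\in\mathbb{PR}^1$ and $C\in\mathbb R$. Suppose that for $\mu$-almost every $\underline a\in\Sigma$, \[ \lim_{N\to\infty}\liminf_{n\to\infty}\frac{1}{N\log 2}\,\frac1n\sum_{i=1}^n H_{2^{-(i+1)N}}\big(\pi_\theta(\mu_{[a_1\cdots a_{n_i}]})\big)\ \ge\ C, \] where $n_i=n_i(\underline a,N,\theta)$. Then $\dim_H\pi_\theta(\mu)\ge C$.
   Context: $\Sigma=\{1,\dots,k\}^{\mathbb N}$, with cylinders $[a_1\cdots a_n]=\{\underline b\in\Sigma:b_j=a_j, j\le n\}$. A Bernoulli measure is a product measure $p^{\mathbb N}$. The coding map $\Pi:\Sigma\to D$ sends $\underline a$ to $\bigcap_n D_{a_1\cdots a_n}$, where $D_w=T_{a_1}\circ\cdots\circ T_{a_n}(D)$ for $w=a_1\cdots a_n$. For $\theta\in\mathbb{PR}^1$ (lines through the origin), $\pi_\theta$ is orthogonal projection of $D$ onto the diameter of $D$ perpendicular to $\theta$, identified isometrically with $[-1,1]$; for a measure $\nu$ on $\Sigma$, $\pi_\theta(\nu)$ denotes the push-forward under $\pi_\theta\circ\Pi$. $\mu_{[w]}=\mu|_{[w]}/\mu([w])$. The length function is $|w|_\theta=-\log_2(|\pi_\theta(D_w)|/2)$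 (interval length), with $|\emptyset|_\theta=0$; it is strictly increasing along $a_1,a_1a_2,\dots$ and tends to infinity. For $\underline a\in\Sigma$, $N,j\in\mathbb N$, $n_j=n_j(\underline a,N,\theta)$ is the natural number with $|a_1\cdots a_{n_j-1}|_\theta<Nj\le|a_1\cdots a_{n_j}|_\theta$. For a probability measure $\nu$ on $[-1,1]$ and $r>0$, the $r$-scale entropy is $H_r(\nu)=-\int\log\nu(B_r(x))\,d\nu(x)$ (natural logarithm). $\dim_H\nu=\inf\{\dim_H U:\nu(U^c)=0\}$. *)

theory Defs
  imports "HOL-Analysis.Analysis" "HOL-Probability.Probability"
begin

text \<open>Symbols: a finite type 'a with k = CARD('a) elements; Sigma = (nat => 'a),
  sequences indexed from 0 (a 0 plays the role of a_1).\<close>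

definition bernoulli :: "'a pmf \<Rightarrow> (nat \<Rightarrow> 'a) measure" where
  "bernoulli p = PiM UNIV (\<lambda>_. measure_pmf p)"

definition prefix :: "(nat \<Rightarrow> 'a) \<Rightarrow> nat \<Rightarrow> 'a list" where
  "prefix a n = map a [0..<n]"

definition cyl :: "'a list \<Rightarrow> (nat \<Rightarrow> 'a) set" where
  "cyl w = {b. \<forall>j<length w. b j = w ! j}"

definition compT :: "('a \<Rightarrow> real^2 \<Rightarrow> real^2) \<Rightarrow> 'a list \<Rightarrow> real^2 \<Rightarrow> real^2" where
  "compT T w = foldr (\<lambda>i f. T i \<circ> f) w id"

definition Dw :: "('a \<Rightarrow> real^2 \<Rightarrow> real^2) \<Rightarrow> 'a list \<Rightarrow> (real^2) set" where
  "Dw T w = compT T w ` cball 0 1"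

definition coding :: "('a \<Rightarrow> real^2 \<Rightarrow> real^2) \<Rightarrow> (nat \<Rightarrow> 'a) \<Rightarrow> real^2" where
  "coding T a = (THE x. x \<in> (\<Inter>n. Dw T (prefix a n)))"

text \<open>A direction theta in PR^1 is represented by a unit vector u spanning the line;
  pi_theta is orthogonal projection onto the perpendicular diameter, identified
  isometrically with [-1,1] via the unit normal perp u.\<close>
definition perp :: "real^2 \<Rightarrow> real^2" where
  "perp u = vector [- (u $ 2), u $ 1]"

definition proj :: "real^2 \<Rightarrow> real^2 \<Rightarrow> real" where
  "proj u x = x \<bullet> perp u"

definition wlen :: "('a \<Rightarrow> real^2 \<Rightarrow> real^2) \<Rightarrow> real^2 \<Rightarrow> 'a list \<Rightarrow> real" where
  "wlen T u w = - log 2 (diameter (proj u ` Dw T w) / 2)"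

definition nj :: "('a \<Rightarrow> real^2 \<Rightarrow> real^2) \<Rightarrow> real^2 \<Rightarrow> (nat \<Rightarrow> 'a) \<Rightarrow> nat \<Rightarrow> nat \<Rightarrow> nat" where
  "nj T u a N j = (LEAST n. real (N * j) \<le> wlen T u (prefix a n))"

definition cond_cyl :: "(nat \<Rightarrow> 'a) measure \<Rightarrow> 'a list \<Rightarrow> (nat \<Rightarrow> 'a) measure" where
  "cond_cyl \<mu> w = density \<mu> (\<lambda>b. indicator (cyl w) b / emeasure \<mu> (cyl w))"

definition proj_meas :: "('a \<Rightarrow> real^2 \<Rightarrow> real^2) \<Rightarrow> real^2 \<Rightarrow> (nat \<Rightarrow> 'a) measure \<Rightarrow> real measure" where
  "proj_meas T u \<nu> = distr \<nu> borel (\<lambda>a. proj u (coding T a))"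

definition scale_entropy :: "real \<Rightarrow> real measure \<Rightarrow> real" where
  "scale_entropy r \<nu> = - (\<integral>x. ln (measure \<nu> (ball x r)) \<partial>\<nu>)"

definition hausdorff_delta :: "real \<Rightarrow> real \<Rightarrow> real set \<Rightarrow> ennreal" where
  "hausdorff_delta s \<delta> U = (INF C \<in> {C :: nat \<Rightarrow> real set.
      (\<forall>i. bounded (C i) \<and> diameter (C i) \<le> \<delta>) \<and> U \<subseteq> (\<Union>i. C i)}.
      (\<Sum>i. ennreal (diameter (C i) powr s)))"

definition hausdorff_measure :: "real \<Rightarrow> real set \<Rightarrow> ennreal" where
  "hausdorff_measure s U = (SUP \<delta>\<in>{0<..}. hausdorff_delta s \<delta> U)"

definition hausdorff_dim :: "real set \<Rightarrow> real" where
  "hausdorff_dim U = Inf {s. s > 0 \<and> hausdorff_measure s U = 0}"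

definition hausdorff_dim_measure :: "real measure \<Rightarrow> real" where
  "hausdorff_dim_measure \<nu> =
     Inf {hausdorff_dim U | U. U \<in> sets borel \<and> emeasure \<nu> (UNIV - U) = 0}"

end

theory Submission
  imports Defs
begin

text \<open>Fix a scale \<open>\<rho> = 2\<^sup>-\<^sup>N\<close> and cut every sequence at the first prefix whose projected disc has
  half-width at most \<open>\<rho>\<^sup>j\<close>. The centre of that disc falls into a cell of the grid of mesh \<open>\<rho>\<^sup>j\<close>;
  let \<open>P j\<close> be the conditional probability, given the stage-\<open>j\<close> prefix, of the cell at stage
  \<open>j + 1\<close>. Up to a constant independent of \<open>N\<close>, the conditional expectation of \<open>- ln (P j)\<close> is at
  least the \<open>\<rho>\<^sup>j\<^sup>+\<^sup>1\<close>-scale entropy of the conditioned projection. An exponential moment estimate and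
  Borel--Cantelli then bound the product \<open>P 1 \<cdots> P n\<close> almost surely by the exponential of minus
  the entropy sum. A cell at stage \<open>j + 1\<close> is reachable from at most four cells at stage \<open>j\<close>, so on
  the set where the product is small the mass over a ball of radius \<open>\<rho>\<^sup>n\<close> exceeds the product by a
  factor of order \<open>4\<^sup>n\<close> only, which is negligible as \<open>N\<close> grows; conclude by mass distribution.

  The matrices may be singular, and then projected discs can collapse to points. If this happens
  almost surely, the Perron--Frobenius theorem makes the normal of the line a common eigenvector of
  all transposes, the collapse time has finite mean, all entropies are bounded, and \<open>C \<le> 0\<close>.\<close>

section \<open>Entropy at a scale and entropy of a partition\<close>

text \<open>Images of different words may overlap, so the product of the \<open>P j\<close> along
  one chain of words is not the mass of any cell. Ball masses are therefore reached indirectly,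
  through the integral of the inverse product over a cell; this is where the factor
  \<open>4 ^ n\<close> arises. The logarithm of \<open>P j\<close> is unbounded below, but the
  conditional mean of \<open>1 / P j\<close> is at most the number of reachable cells, hence at most
  \<open>2 * R + 1\<close> with \<open>R = 2 ^ N\<close>. This bounds the second moment of the
  logarithm and makes the exponential moment estimate work with \<open>t = 1 / (2 * R + 1)\<close>.
  The loss per stage is \<open>ln 3\<close> (entropy against partition), \<open>ln 4\<close>
  (predecessor cells) and 1 (slack in the large deviation bound), together \<open>ln 12 + 1\<close>
  whatever \<open>N\<close> is, while the entropy per stage is of order \<open>N * ln 2 * C\<close>.
  The hypothesis provides a good \<open>N\<close> for each sequence separately. Countability yields
  one \<open>N\<close> that is good on a non-null set of sequences, and a part of positive mass is
  enough for the dimension.\<close>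

lemma exp_minus_le_quadratic:
  fixes x :: real
  assumes "0 \<le> x"
  shows "exp (- x) \<le> 1 - x + x\<^sup>2 / 2"
proof -
  have q: "1 + x + x\<^sup>2 / 2 \<le> exp x"
    using exp_lower_Taylor_quadratic[OF assms] by simp
  \<comment> \<open>The product equals \<open>1 + x ^ 4 / 4\<close>.\<close>
  have "1 \<le> (1 - x + x\<^sup>2 / 2) * (1 + x + x\<^sup>2 / 2)"
    using zero_le_power2[of "x\<^sup>2"] by (simp add: algebra_simps power2_eq_square)
  also have "\<dots> \<le> (1 - x + x\<^sup>2 / 2) * exp x"
  proof (rule mult_left_mono[OF q])
    have "0 \<le> (x - 1)\<^sup>2 + 1" by simp
    then show "0 \<le> 1 - x + x\<^sup>2 / 2" by (simp add: power2_eq_square algebra_simps)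
  qed
  finally show ?thesis by (simp add: exp_minus field_simps)
qed

text \<open>With \<open>y = x powr (-1/4)\<close>, \<open>ln y \<le> y - 1\<close> gives
  \<open>- ln x \<le> 4 * (y - 1) \<le> y\<^sup>2\<close>, and \<open>y ^ 4 = 1 / x\<close>. The
  purpose is to bound the second moment of \<open>ln P\<close> by the mean of
  \<open>1 / P\<close>.\<close>

lemma ln_squared_le_inverse:
  fixes x :: real
  assumes "0 < x" "x \<le> 1"
  shows "(ln x)\<^sup>2 \<le> 1 / x"
proof -
  define y where "y = x powr (-1/4)"
  have y: "0 < y" using assms by (simp add: y_def)
  have "y ^ 4 = x powr (- 1)"
    using assms unfolding y_def by (subst powr_power) auto
  then have xy: "x * y ^ 4 = 1" using assms by (simp add: powr_minus)
  have "ln y = -1/4 * ln x" using assms by (simp add: y_def ln_powr)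
  moreover have "ln y \<le> y - 1" using y by (rule ln_le_minus_one)
  ultimately have "- ln x \<le> 4 * (y - 1)" by simp
  also have "\<dots> \<le> y\<^sup>2"
    using zero_le_power2[of "y - 2"] by (simp add: power2_eq_square algebra_simps)
  finally have "(- ln x)\<^sup>2 \<le> (y\<^sup>2)\<^sup>2"
    using assms by (intro power_mono) auto
  also have "(y\<^sup>2)\<^sup>2 = 1 / x"
    using xy assms by (simp add: field_simps flip: power_mult)
  finally show ?thesis by simp
qed

lemma nn_integral_finite_range:
  assumes "finite K" "AE x in M. g x \<in> K"
    and "\<And>i. i \<in> K \<Longrightarrow> {x\<in>space M. g x = i} \<in> sets M"
  shows "(\<integral>\<^sup>+x. \<phi> (g x) \<partial>M) = (\<Sum>i\<in>K. \<phi> i * emeasure M {x\<in>space M. g x = i})"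
proof -
  have "(\<integral>\<^sup>+x. \<phi> (g x) \<partial>M)
      = (\<integral>\<^sup>+x. (\<Sum>i\<in>K. \<phi> i * indicator {x\<in>space M. g x = i} x) \<partial>M)"
  proof (rule nn_integral_cong_AE)
    show "AE x in M. \<phi> (g x) = (\<Sum>i\<in>K. \<phi> i * indicator {x\<in>space M. g x = i} x)"
      using assms(2) AE_space
    proof eventually_elim
      case (elim x)
      have "(\<Sum>i\<in>K. \<phi> i * indicator {x\<in>space M. g x = i} x)
          = (\<Sum>i\<in>K. if g x = i then \<phi> i else 0)"
        using elim by (intro sum.cong) (auto split: split_indicator)
      then show ?case using elim assms(1) by simp
    qed
  qed
  also have "\<dots> = (\<Sum>i\<in>K. \<integral>\<^sup>+x. \<phi> i * indicator {x\<in>space M. g x = i} x \<partial>M)"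
    using assms(3) by (intro nn_integral_sum) auto
  also have "\<dots> = (\<Sum>i\<in>K. \<phi> i * emeasure M {x\<in>space M. g x = i})"
    using assms(3) by (intro sum.cong nn_integral_cmult_indicator) auto
  finally show ?thesis .
qed

lemma (in prob_space) AE_prob_fibre_pos:
  assumes "finite K" "AE x in M. g x \<in> K"
    and "\<And>i. i \<in> K \<Longrightarrow> {x\<in>space M. g x = i} \<in> sets M"
  shows "AE x in M. 0 < prob {y\<in>space M. g y = g x}"
proof -
  have "AE x in M. \<forall>i\<in>K. prob {y\<in>space M. g y = i} = 0 \<longrightarrow> g x \<noteq> i"
  proof (rule AE_finite_allI[OF assms(1)])
    fix i assume "i \<in> K"
    show "AE x in M. prob {y\<in>space M. g y = i} = 0 \<longrightarrow> g x \<noteq> i"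
    proof (cases "prob {y\<in>space M. g y = i} = 0")
      case True
      then have "{y\<in>space M. g y = i} \<in> null_sets M"
        using assms(3)[OF \<open>i \<in> K\<close>] by (auto simp: emeasure_eq_measure null_sets_def)
      from AE_not_in[OF this] show ?thesis using AE_space by eventually_elim auto
    qed auto
  qed
  with assms(2) show ?thesis
    by eventually_elim (auto simp: zero_less_measure_iff)
qed

lemma borel_measurable_measure_ball:
  assumes "prob_space \<nu>" and [measurable_cong]: "sets \<nu> = sets (borel :: real measure)"
  shows "(\<lambda>x. measure \<nu> (ball x r)) \<in> borel_measurable borel"
proof -
  interpret prob_space \<nu> by fact
  have "{z \<in> space (borel \<Otimes>\<^sub>M \<nu>). dist (fst z) (snd z) < r} \<in> sets ((borel :: real measure) \<Otimes>\<^sub>M \<nu>)"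
    by measurable
  from measurable_emeasure_Pair[OF this]
  have "(\<lambda>x. emeasure \<nu> (Pair x -` {z \<in> space (borel \<Otimes>\<^sub>M \<nu>). dist (fst z) (snd z) < r}))
      \<in> borel_measurable borel" .
  moreover have "Pair x -` {z \<in> space (borel \<Otimes>\<^sub>M \<nu>). dist (fst z) (snd z) < r} = ball x r" for x
    using sets_eq_imp_space_eq[OF assms(2)] by (auto simp: space_pair_measure)
  ultimately show ?thesis by (simp add: measure_def)
qed

lemma (in prob_space) scale_entropy_distr:
  assumes [measurable]: "f \<in> borel_measurable M"
  shows "scale_entropy r (distr M borel f)
    = (\<integral>x. - ln (prob {y\<in>space M. f y \<in> ball (f x) r}) \<partial>M)"
proof -
  have [measurable]: "(\<lambda>x. measure (distr M borel f) (ball x r)) \<in> borel_measurable borel"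
    by (rule borel_measurable_measure_ball) (auto intro: prob_space_distr)
  have "scale_entropy r (distr M borel f)
      = - (\<integral>x. ln (measure (distr M borel f) (ball (f x) r)) \<partial>M)"
    unfolding scale_entropy_def by (subst integral_distr) auto
  also have "\<dots> = (\<integral>x. - ln (prob {y\<in>space M. f y \<in> ball (f x) r}) \<partial>M)"
    by (simp add: measure_distr vimage_def Int_def conj_commute)
  finally show ?thesis .
qed

text \<open>The majorant is also required to be non-negative because the Bochner integral of a
  non-integrable function is 0; the bound then holds even if the entropy integrand is not
  integrable.\<close>

lemma (in prob_space) scale_entropy_le_integral:
  assumes [measurable]: "f \<in> borel_measurable M" and g: "integrable M g"
    and "AE x in M. 0 \<le> g x \<and> - ln (prob {y\<in>space M. f y \<in> ball (f x) r}) \<le> g x"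
  shows "scale_entropy r (distr M borel f) \<le> (\<integral>x. g x \<partial>M)"
  unfolding scale_entropy_distr[OF assms(1)]
  using assms(3) by (intro integral_mono_AE' g) auto

text \<open>The estimate for a single stage: \<open>m\<close> is the cell label of a centre and
  \<open>f\<close> the limit point. A second-order expansion of \<open>P powr t\<close> needs the
  mean of \<open>ln P\<close>, which is at most minus the entropy plus \<open>ln 3\<close>, and its
  second moment, which is at most \<open>card K\<close>.\<close>

lemma (in prob_space) integral_prob_fibre_powr_le:
  fixes m :: "'a \<Rightarrow> int" and f :: "'a \<Rightarrow> real"
  assumes m[measurable]: "m \<in> measurable M (count_space UNIV)"
    and f[measurable]: "f \<in> borel_measurable M"
    and K: "finite K" "AE x in M. m x \<in> K"
    and near: "AE x in M. (of_int (m x) - 1) * r \<le> f x \<and> f x < (of_int (m x) + 2) * r"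
    and r: "0 < r" and t: "0 < t"
  shows "(\<integral>\<^sup>+x. ennreal (prob {y\<in>space M. m y = m x} powr t) \<partial>M)
    \<le> ennreal (exp (- t * (scale_entropy r (distr M borel f) - ln 3) + t\<^sup>2 * card K / 2))"
proof -
  define k where "k x = \<lfloor>f x / r\<rfloor>" for x
  define P where "P x = prob {y\<in>space M. m y = m x}" for x
  define Q where "Q x = prob {y\<in>space M. k y = k x}" for x
  have k[measurable]: "k \<in> measurable M (count_space UNIV)"
    unfolding k_def by measurable
  have [measurable]: "P \<in> borel_measurable M" "Q \<in> borel_measurable M"
    unfolding P_def Q_def
    by (rule measurable_compose[OF m], simp, rule measurable_compose[OF k], simp)
  \<comment> \<open>\<open>near\<close> forces the label \<open>k\<close> of the point to differ
    from the label \<open>m\<close> of the centre by at most 1, so each \<open>m\<close>-cell meets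
    at most three \<open>k\<close>-cells.\<close>
  define S where "S = (SIGMA i:K. {i-1..i+1})"
  have finS: "finite S" using K by (auto simp: S_def)
  have AES: "AE x in M. (m x, k x) \<in> S"
    using near K(2)
  proof eventually_elim
    case (elim x)
    then have "of_int (m x) - 1 \<le> f x / r" "f x / r < of_int (m x) + 2"
      using r by (simp_all add: field_simps)
    then have "m x - 1 \<le> k x \<and> k x \<le> m x + 1"
      unfolding k_def by linarith
    then show ?case using elim by (auto simp: S_def)
  qed
  have AEk: "AE x in M. k x \<in> snd ` S"
    using AES by eventually_elim force
  have posP: "AE x in M. 0 < P x"
    unfolding P_def by (rule AE_prob_fibre_pos[OF K]) measurable
  have posQ: "AE x in M. 0 < Q x"
    unfolding Q_def by (rule AE_prob_fibre_pos[OF finite_imageI[OF finS] AEk]) measurable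
  have P1: "P x \<le> 1" and Q1: "Q x \<le> 1" for x by (auto simp: P_def Q_def)
  have P0: "0 \<le> P x" and Q0: "0 \<le> Q x" for x by (auto simp: P_def Q_def)
  \<comment> \<open>Each label of positive probability contributes exactly 1, and a null label
    contributes 0.\<close>
  have inv_le: "(\<integral>\<^sup>+x. ennreal (1 / P x) \<partial>M) \<le> ennreal (card K)"
  proof -
    have "(\<integral>\<^sup>+x. ennreal (1 / P x) \<partial>M)
        = (\<Sum>i\<in>K. ennreal (1 / prob {y\<in>space M. m y = i}) * emeasure M {y\<in>space M. m y = i})"
      unfolding P_def by (rule nn_integral_finite_range[OF K]) measurable
    also have "\<dots> \<le> (\<Sum>i\<in>K. 1)"
      by (intro sum_mono) (auto simp: emeasure_eq_measure simp flip: ennreal_mult)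
    finally show ?thesis by (simp add: ennreal_of_nat_eq_real_of_nat)
  qed
  \<comment> \<open>A pair \<open>(i, j)\<close> contributes the probability of \<open>m = i\<close>
    times the conditional probability of \<open>m = i\<close> given \<open>k = j\<close>. Bounding
    the latter by 1 leaves each label \<open>i\<close> counted three times.\<close>
  have quot_le: "(\<integral>\<^sup>+x. ennreal (P x / Q x) \<partial>M) \<le> ennreal 3"
  proof -
    have "(\<integral>\<^sup>+x. ennreal (P x / Q x) \<partial>M)
        = (\<Sum>(i,j)\<in>S. ennreal (prob {y\<in>space M. m y = i} / prob {y\<in>space M. k y = j})
             * emeasure M {y\<in>space M. (m y, k y) = (i, j)})"
    proof -
      have sets: "{y\<in>space M. (m y, k y) = z} \<in> sets M" for z
        by (cases z) simp
      show ?thesis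
        using nn_integral_finite_range[OF finS AES sets, where
          \<phi> = "\<lambda>(i,j). ennreal (prob {y\<in>space M. m y = i} / prob {y\<in>space M. k y = j})"]
        unfolding P_def Q_def by (simp add: case_prod_unfold prod_eq_iff)
    qed
    also have "\<dots> \<le> (\<Sum>(i,j)\<in>S. ennreal (prob {y\<in>space M. m y = i}))"
    proof (intro sum_mono, safe)
      fix i j
      have le: "prob {y\<in>space M. (m y, k y) = (i, j)} \<le> prob {y\<in>space M. k y = j}"
        by (rule finite_measure_mono) auto
      have "prob {y\<in>space M. m y = i} / prob {y\<in>space M. k y = j}
             * prob {y\<in>space M. (m y, k y) = (i, j)}
          \<le> prob {y\<in>space M. m y = i}"
      proof (cases "prob {y\<in>space M. k y = j} = 0")
        case False
        then have "0 < prob {y\<in>space M. k y = j}" by (simp add: zero_less_measure_iff)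
        then show ?thesis using mult_left_mono[OF le, of "prob {y\<in>space M. m y = i}"]
          by (simp add: field_simps)
      qed auto
      then show "ennreal (prob {y\<in>space M. m y = i} / prob {y\<in>space M. k y = j})
             * emeasure M {y\<in>space M. (m y, k y) = (i, j)}
          \<le> ennreal (prob {y\<in>space M. m y = i})"
        unfolding emeasure_eq_measure
        by (subst ennreal_mult[symmetric]) (auto intro: ennreal_leI simp del: Pair_inject)
    qed
    also have "\<dots> = (\<Sum>i\<in>K. \<Sum>j\<in>{i-1..i+1}. ennreal (prob {y\<in>space M. m y = i}))"
      unfolding S_def using K by (subst sum.Sigma) auto
    also have "\<dots> = (\<Sum>i\<in>K. ennreal (3 * prob {y\<in>space M. m y = i}))"
      by (intro sum.cong refl) (simp add: ennreal_mult)
    also have "\<dots> = ennreal (\<Sum>i\<in>K. 3 * prob {y\<in>space M. m y = i})"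
      by (intro sum_ennreal) auto
    also have "\<dots> \<le> ennreal 3"
    proof -
      have "(\<Sum>i\<in>K. prob {y\<in>space M. m y = i}) = prob (\<Union>i\<in>K. {y\<in>space M. m y = i})"
        using K by (intro finite_measure_finite_Union[symmetric]) (auto simp: disjoint_family_on_def)
      then have "(\<Sum>i\<in>K. prob {y\<in>space M. m y = i}) \<le> 1" by simp
      then show ?thesis by (intro ennreal_leI) (simp flip: sum_distrib_left)
    qed
    finally show ?thesis .
  qed
  have int_inv: "integrable M (\<lambda>x. 1 / P x)"
  proof (rule integrableI_nonneg)
    show "(\<integral>\<^sup>+x. ennreal (1 / P x) \<partial>M) < \<infinity>"
      using le_less_trans[OF inv_le ennreal_less_top] by (simp only: infinity_ennreal_def)
    show "AE x in M. 0 \<le> 1 / P x" using P0 by (intro AE_I2 divide_nonneg_nonneg) auto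
  qed measurable
  have int_quot: "integrable M (\<lambda>x. P x / Q x)"
  proof (rule integrableI_nonneg)
    show "(\<integral>\<^sup>+x. ennreal (P x / Q x) \<partial>M) < \<infinity>"
      using le_less_trans[OF quot_le ennreal_less_top] by (simp only: infinity_ennreal_def)
    show "AE x in M. 0 \<le> P x / Q x" using P0 Q0 by (intro AE_I2 divide_nonneg_nonneg) auto
  qed measurable
  have inv_le': "(\<integral>x. 1 / P x \<partial>M) \<le> card K"
  proof -
    have "(\<integral>\<^sup>+x. ennreal (1 / P x) \<partial>M) = ennreal (\<integral>x. 1 / P x \<partial>M)"
      using P0 by (intro nn_integral_eq_integral int_inv AE_I2 divide_nonneg_nonneg) auto
    then show ?thesis using inv_le by simp
  qed
  have quot_le': "(\<integral>x. P x / Q x \<partial>M) \<le> 3"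
  proof -
    have "(\<integral>\<^sup>+x. ennreal (P x / Q x) \<partial>M) = ennreal (\<integral>x. P x / Q x \<partial>M)"
      using P0 Q0 by (intro nn_integral_eq_integral int_quot AE_I2 divide_nonneg_nonneg) auto
    with quot_le have "ennreal (\<integral>x. P x / Q x \<partial>M) \<le> ennreal 3" by simp
    then show ?thesis by (subst (asm) ennreal_le_iff) simp_all
  qed
  have int_ln: "integrable M (\<lambda>x. ln (P x))"
  proof (rule Bochner_Integration.integrable_bound[OF int_inv])
    show "AE x in M. norm (ln (P x)) \<le> norm (1 / P x)"
      using posP
    proof eventually_elim
      case (elim x)
      have "ln (1 / P x) \<le> 1 / P x - 1" using elim by (intro ln_le_minus_one) auto
      then show ?case using elim P1[of x] by (simp add: ln_div)
    qed
  qed simp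
  define H where "H = scale_entropy r (distr M borel f)"
  \<comment> \<open>\<open>ln y \<le> y - 1\<close> at \<open>y = P / (3 Q)\<close> passes from the fine partition \<open>k\<close> to the coarse one \<open>m\<close>
    at the cost of \<open>ln 3\<close>, because \<open>P / Q\<close> has mean at most 3.\<close>
  have "H \<le> (\<integral>x. - ln (P x) + P x / Q x / 3 - 1 + ln 3 \<partial>M)"
    unfolding H_def
  proof (rule scale_entropy_le_integral)
    show "AE x in M. 0 \<le> - ln (P x) + P x / Q x / 3 - 1 + ln 3 \<and>
         - ln (prob {y \<in> space M. f y \<in> ball (f x) r}) \<le> - ln (P x) + P x / Q x / 3 - 1 + ln 3"
      using posP posQ
    proof eventually_elim
      case (elim x)
      \<comment> \<open>Points with equal floors of \<open>f / r\<close> are less than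
        \<open>r\<close> apart, so the \<open>k\<close>-cell of \<open>x\<close> lies in the
        ball.\<close>
      have "Q x \<le> prob {y \<in> space M. f y \<in> ball (f x) r}"
        unfolding Q_def
      proof (rule finite_measure_mono)
        show "{y \<in> space M. k y = k x} \<subseteq> {y \<in> space M. f y \<in> ball (f x) r}"
        proof safe
          fix y assume "y \<in> space M" "k y = k x"
          then have "\<bar>f x / r - f y / r\<bar> < 1" unfolding k_def by linarith
          then have "\<bar>f x - f y\<bar> < r" using r by (simp add: field_simps flip: diff_divide_distrib)
          then show "f y \<in> ball (f x) r" by (simp add: dist_real_def)
        qed
      qed (unfold mem_ball, measurable)
      then have 1: "- ln (prob {y \<in> space M. f y \<in> ball (f x) r}) \<le> - ln (Q x)"
        using elim by simp
      have "ln (P x / Q x / 3) \<le> P x / Q x / 3 - 1"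
        using elim by (intro ln_le_minus_one) auto
      then have 2: "- ln (Q x) \<le> - ln (P x) + P x / Q x / 3 - 1 + ln 3"
        using elim by (simp add: ln_div ln_mult)
      have "0 \<le> - ln (Q x)" using elim Q1[of x] by simp
      with 1 2 show ?case by linarith
    qed
  qed (measurable, intro Bochner_Integration.integrable_add Bochner_Integration.integrable_diff
      Bochner_Integration.integrable_minus integrable_divide integrable_const int_ln int_quot)
  also have "\<dots> \<le> - (\<integral>x. ln (P x) \<partial>M) + ln 3"
    using int_ln int_quot quot_le' by (simp add: prob_space del: divide_divide_eq_left)
  finally have H: "(\<integral>x. ln (P x) \<partial>M) \<le> - H + ln 3" by simp
  have int_pow: "integrable M (\<lambda>x. P x powr t)"
    using P0 P1 t by (intro integrable_const_bound[of _ 1]) (auto intro!: powr_le1 AE_I2)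
  define G where "G = (\<lambda>x. 1 / P x)"
  have int_G: "integrable M G" and G_le: "(\<integral>x. G x \<partial>M) \<le> card K"
    using int_inv inv_le' by (simp_all add: G_def)
  \<comment> \<open>The quadratic bound on \<open>exp (- x)\<close> is applied at
    \<open>x = - t * ln P\<close>, which is non-negative since \<open>P \<le> 1\<close>.\<close>
  have "(\<integral>x. P x powr t \<partial>M) \<le> (\<integral>x. 1 + t * ln (P x) + t\<^sup>2 / 2 * G x \<partial>M)"
  proof (rule integral_mono_AE[OF int_pow])
    show "AE x in M. P x powr t \<le> 1 + t * ln (P x) + t\<^sup>2 / 2 * G x"
      using posP
    proof eventually_elim
      case (elim x)
      have "P x powr t = exp (- (t * (- ln (P x))))" using elim by (simp add: powr_def)
      also have "\<dots> \<le> 1 - t * (- ln (P x)) + (t * (- ln (P x)))\<^sup>2 / 2"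
        using elim P1[of x] t by (intro exp_minus_le_quadratic mult_nonneg_nonneg) auto
      also have "\<dots> = 1 + t * ln (P x) + t\<^sup>2 / 2 * (ln (P x))\<^sup>2"
        by (simp add: power_mult_distrib)
      also have "\<dots> \<le> 1 + t * ln (P x) + t\<^sup>2 / 2 * G x"
        using ln_squared_le_inverse[OF elim P1] unfolding G_def by (intro add_left_mono mult_left_mono) auto
      finally show ?case .
    qed
  qed (use int_ln int_G in auto)
  also have "\<dots> = 1 + t * (\<integral>x. ln (P x) \<partial>M) + t\<^sup>2 / 2 * (\<integral>x. G x \<partial>M)"
    using int_ln int_G by (simp add: prob_space)
  also have "\<dots> \<le> 1 + t * (- H + ln 3) + t\<^sup>2 / 2 * card K"
    using t H G_le by (intro add_mono mult_left_mono) auto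
  also have "\<dots> \<le> exp (- t * (H - ln 3) + t\<^sup>2 * card K / 2)"
    using exp_ge_add_one_self[of "- t * (H - ln 3) + t\<^sup>2 * card K / 2"]
    by (simp add: algebra_simps)
  finally have "(\<integral>x. P x powr t \<partial>M) \<le> exp (- t * (H - ln 3) + t\<^sup>2 * card K / 2)" .
  then show ?thesis
    unfolding H_def P_def[symmetric]
    by (subst nn_integral_eq_integral[OF int_pow]) (auto intro: ennreal_leI)
qed

section \<open>Local entropy averages along refining partitions\<close>

lemma simple_function_factor:
  assumes "simple_function M V"
    and "\<And>x y. x \<in> space M \<Longrightarrow> y \<in> space M \<Longrightarrow> V x = V y \<Longrightarrow> g x = g y"
  shows "simple_function M g"
proof -
  define h where "h w = g (SOME x. x \<in> space M \<and> V x = w)" for w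
  have "g x = h (V x)" if "x \<in> space M" for x
  proof -
    have "\<exists>y. y \<in> space M \<and> V y = V x" using that by blast
    from someI_ex[OF this] have "g (SOME y. y \<in> space M \<and> V y = V x) = g x"
      by (intro assms(2)) (use that in simp_all)
    then show ?thesis unfolding h_def by simp
  qed
  then show ?thesis
    using simple_function_compose1[OF assms(1), of h] by (simp cong: simple_function_cong)
qed

text \<open>The atoms of the \<open>j\<close>-th partition are the fibres of \<open>W j\<close>.\<close>

locale refining_partitions = prob_space M for M :: "'x measure" +
  fixes W :: "nat \<Rightarrow> 'x \<Rightarrow> 'w" and c :: "nat \<Rightarrow> 'x \<Rightarrow> real" and f :: "'x \<Rightarrow> real" and R :: nat
  assumes simple_W: "simple_function M (W j)"
    and refine: "x \<in> space M \<Longrightarrow> y \<in> space M \<Longrightarrow> W (Suc j) x = W (Suc j) y \<Longrightarrow> W j x = W j y"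
    and c_cong: "x \<in> space M \<Longrightarrow> y \<in> space M \<Longrightarrow> W j x = W j y \<Longrightarrow> c j x = c j y"
    and f_meas[measurable]: "f \<in> borel_measurable M"
    and R_pos: "0 < R"
    and f_near: "x \<in> space M \<Longrightarrow> \<bar>f x - c j x\<bar> \<le> (1 / R) ^ j"
    and c_step: "x \<in> space M \<Longrightarrow> \<bar>c (Suc j) x - c j x\<bar> \<le> (1 / R) ^ j"
begin

definition atom :: "nat \<Rightarrow> 'x \<Rightarrow> 'x set" where
  "atom j x = {y\<in>space M. W j y = W j x}"

definition cond :: "nat \<Rightarrow> 'x \<Rightarrow> 'x measure" where
  "cond j x = uniform_measure M (atom j x)"

text \<open>The label is read off the centre instead of \<open>f\<close>, so that it is constant on
  the atoms of stage \<open>j\<close>.\<close>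

definition cell :: "nat \<Rightarrow> 'x \<Rightarrow> int" where
  "cell j x = \<lfloor>c j x * real R ^ j\<rfloor>"

definition P :: "nat \<Rightarrow> 'x \<Rightarrow> real" where
  "P j x = measure (cond j x) {y\<in>space M. cell (Suc j) y = cell (Suc j) x}"

definition H :: "nat \<Rightarrow> 'x \<Rightarrow> real" where
  "H j x = scale_entropy ((1 / R) ^ Suc j) (distr (cond j x) borel f)"

definition q :: "nat \<Rightarrow> 'x \<Rightarrow> real" where
  "q n x = (\<Prod>j=1..n. P j x)"

lemma refine_le:
  assumes "x \<in> space M" "y \<in> space M" "i \<le> j" "W j x = W j y"
  shows "W i x = W i y"
  using assms(3,4) by (induction rule: dec_induct) (auto intro: refine assms(1,2))

lemma cond_cong: "W j x = W j y \<Longrightarrow> cond j x = cond j y"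
  unfolding cond_def atom_def by simp

lemma H_cong: "W j x = W j y \<Longrightarrow> H j x = H j y"
  unfolding H_def by (simp only: cond_cong[of j x y])

lemma cell_cong: "x \<in> space M \<Longrightarrow> y \<in> space M \<Longrightarrow> W j x = W j y \<Longrightarrow> cell j x = cell j y"
  using c_cong[of x y j] by (simp add: cell_def)

lemma P_cong:
  assumes "x \<in> space M" "y \<in> space M" "W (Suc j) x = W (Suc j) y"
  shows "P j x = P j y"
  using cond_cong[OF refine[OF assms]] cell_cong[OF assms] by (simp add: P_def)

lemma q_cong:
  assumes "x \<in> space M" "y \<in> space M" "W (Suc n) x = W (Suc n) y"
  shows "q n x = q n y"
  unfolding q_def
  by (intro prod.cong refl P_cong assms(1,2) refine_le[OF assms(1,2) _ assms(3)]) auto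

lemma measurable_factor:
  fixes g :: "'x \<Rightarrow> 'b :: topological_space"
  assumes "\<And>x y. x \<in> space M \<Longrightarrow> y \<in> space M \<Longrightarrow> W j x = W j y \<Longrightarrow> g x = g y"
  shows "g \<in> borel_measurable M"
  by (rule borel_measurable_simple_function[OF simple_function_factor[OF simple_W assms]])

lemma P_measurable [measurable]: "P j \<in> borel_measurable M"
  by (rule measurable_factor[of "Suc j"]) (rule P_cong)

lemma q_measurable [measurable]: "q j \<in> borel_measurable M"
  unfolding q_def by measurable

lemma H_measurable [measurable]: "H j \<in> borel_measurable M"
  by (rule measurable_factor[of j]) (rule H_cong)

lemma cell_measurable [measurable]: "cell j \<in> measurable M (count_space UNIV)"
  by (rule measurable_simple_function, rule simple_function_factor[OF simple_W[of j]], rule cell_cong)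

lemma atom_sets [measurable]: "atom j x \<in> sets M"
proof -
  have "atom j x = W j -` {W j x} \<inter> space M" by (auto simp: atom_def)
  then show ?thesis using simple_functionD(2)[OF simple_W] by simp
qed

lemma sets_cond [simp, measurable_cong]: "sets (cond j x) = sets M"
  and space_cond [simp]: "space (cond j x) = space M"
  by (simp_all add: cond_def)

lemma prob_space_cond: "prob (atom j x) \<noteq> 0 \<Longrightarrow> prob_space (cond j x)"
  unfolding cond_def by (rule prob_space_uniform_measure) (auto simp: emeasure_eq_measure)

section \<open>Conditioning on the atoms of one stage\<close>

lemma AE_cond_atom: "AE y in cond j x. y \<in> atom j x"
  unfolding cond_def by (rule AE_uniform_measureI) auto

lemma AE_from_cond:
  assumes "\<And>x. x \<in> space M \<Longrightarrow> prob (atom j x) \<noteq> 0 \<Longrightarrow> AE y in cond j x. \<Phi> y"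
  shows "AE y in M. \<Phi> y"
proof -
  have fin: "finite (W j ` space M)" using simple_functionD(1)[OF simple_W] .
  have "AE y in M. \<forall>w\<in>W j ` space M. W j y = w \<longrightarrow> \<Phi> y"
  proof (rule AE_finite_allI[OF fin])
    fix w assume "w \<in> W j ` space M"
    then obtain x where x: "x \<in> space M" "w = W j x" by blast
    have "AE y in M. y \<in> atom j x \<longrightarrow> \<Phi> y"
    proof (cases "prob (atom j x) = 0")
      case True
      then have "atom j x \<in> null_sets M" by (auto simp: null_sets_def emeasure_eq_measure)
      from AE_not_in[OF this] show ?thesis by eventually_elim auto
    next
      case False
      with assms[OF x(1) False] show ?thesis
        unfolding cond_def by (subst (asm) AE_uniform_measure) (auto simp: emeasure_eq_measure)
    qed
    then show "AE y in M. W j y = w \<longrightarrow> \<Phi> y"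
      using AE_space by eventually_elim (auto simp: atom_def x)
  qed
  then show ?thesis using AE_space by eventually_elim auto
qed

text \<open>The tower property for a finite partition: on each atom the factor \<open>G\<close> is
  constant and comes out of the integral, and the conditional mean of \<open>Y\<close> is replaced
  by its bound \<open>h\<close>. Atoms of mass 0 contribute nothing.\<close>

lemma nn_integral_cond_step:
  fixes G Y h :: "'x \<Rightarrow> ennreal"
  assumes G: "\<And>x y. x \<in> space M \<Longrightarrow> y \<in> space M \<Longrightarrow> W j x = W j y \<Longrightarrow> G x = G y"
    and h: "\<And>x y. x \<in> space M \<Longrightarrow> y \<in> space M \<Longrightarrow> W j x = W j y \<Longrightarrow> h x = h y"
    and Y[measurable]: "Y \<in> borel_measurable M"
    and le: "\<And>x. x \<in> space M \<Longrightarrow> prob (atom j x) \<noteq> 0 \<Longrightarrow> (\<integral>\<^sup>+y. Y y \<partial>cond j x) \<le> h x"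
  shows "(\<integral>\<^sup>+x. G x * Y x \<partial>M) \<le> (\<integral>\<^sup>+x. G x * h x \<partial>M)"
proof -
  have [measurable]: "G \<in> borel_measurable M" "h \<in> borel_measurable M"
    by (rule measurable_factor[of j], erule (2) G, rule measurable_factor[of j], erule (2) h)
  have fin: "finite (W j ` space M)" using simple_functionD(1)[OF simple_W] .
  define D where "D w = {y\<in>space M. W j y = w}" for w
  have D: "D (W j x) = atom j x" for x by (simp add: D_def atom_def)
  have [measurable]: "D w \<in> sets M" if "w \<in> W j ` space M" for w
    using that D by auto
  have split: "(\<integral>\<^sup>+x. F x \<partial>M) = (\<Sum>w\<in>W j ` space M. \<integral>\<^sup>+x. F x * indicator (D w) x \<partial>M)"
    if [measurable]: "F \<in> borel_measurable M" for F
  proof -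
    have "(\<integral>\<^sup>+x. F x \<partial>M) = (\<integral>\<^sup>+x. (\<Sum>w\<in>W j ` space M. F x * indicator (D w) x) \<partial>M)"
    proof (rule nn_integral_cong)
      fix x assume x: "x \<in> space M"
      have "(\<Sum>w\<in>W j ` space M. F x * indicator (D w) x) = (\<Sum>w\<in>W j ` space M. if W j x = w then F x else 0)"
        using x by (intro sum.cong) (auto simp: D_def split: split_indicator)
      then show "F x = (\<Sum>w\<in>W j ` space M. F x * indicator (D w) x)"
        using x fin by simp
    qed
    also have "\<dots> = (\<Sum>w\<in>W j ` space M. \<integral>\<^sup>+x. F x * indicator (D w) x \<partial>M)"
      by (intro nn_integral_sum) measurable
    finally show ?thesis .
  qed
  have "(\<integral>\<^sup>+x. G x * Y x * indicator (D w) x \<partial>M) \<le> (\<integral>\<^sup>+x. G x * h x * indicator (D w) x \<partial>M)"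
    if w: "w \<in> W j ` space M" for w
  proof -
    obtain x where x: "x \<in> space M" "w = W j x" using w by blast
    have eq: "(\<integral>\<^sup>+y. G y * Z y * indicator (D w) y \<partial>M) = G x * (\<integral>\<^sup>+y. Z y * indicator (atom j x) y \<partial>M)"
      if [measurable]: "Z \<in> borel_measurable M" for Z
    proof -
      have "(\<integral>\<^sup>+y. G y * Z y * indicator (D w) y \<partial>M) = (\<integral>\<^sup>+y. G x * (Z y * indicator (atom j x) y) \<partial>M)"
      proof (rule nn_integral_cong)
        fix y assume "y \<in> space M"
        with G[of y x] x show "G y * Z y * indicator (D w) y = G x * (Z y * indicator (atom j x) y)"
          by (cases "W j y = W j x") (simp_all add: D_def atom_def mult.assoc)
      qed
      then show ?thesis by (simp add: nn_integral_cmult)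
    qed
    have "(\<integral>\<^sup>+y. Y y * indicator (atom j x) y \<partial>M) \<le> h x * emeasure M (atom j x)"
    proof (cases "prob (atom j x) = 0")
      case True
      then have "atom j x \<in> null_sets M" by (auto simp: null_sets_def emeasure_eq_measure)
      then show ?thesis by (simp add: nn_integral_null_set)
    next
      case False
      then have "(\<integral>\<^sup>+y. Y y * indicator (atom j x) y \<partial>M) = (\<integral>\<^sup>+y. Y y \<partial>cond j x) * emeasure M (atom j x)"
        unfolding cond_def
        by (simp add: nn_integral_uniform_measure ennreal_divide_times ennreal_mult_divide_eq
            emeasure_eq_measure)
      also have "\<dots> \<le> h x * emeasure M (atom j x)"
        using le[OF x(1) False] by (rule mult_right_mono) simp
      finally show ?thesis .
    qed
    also have "\<dots> = (\<integral>\<^sup>+y. h x * indicator (atom j x) y \<partial>M)"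
      by (simp add: nn_integral_cmult_indicator)
    also have "\<dots> = (\<integral>\<^sup>+y. h y * indicator (atom j x) y \<partial>M)"
    proof (rule nn_integral_cong)
      fix y assume "y \<in> space M"
      with h[of y x] x show "h x * indicator (atom j x) y = h y * indicator (atom j x) y"
        by (cases "W j y = W j x") (simp_all add: atom_def)
    qed
    finally show ?thesis by (simp add: eq mult_left_mono)
  qed
  moreover have "(\<integral>\<^sup>+x. G x * Y x \<partial>M) = (\<Sum>w\<in>W j ` space M. \<integral>\<^sup>+x. G x * Y x * indicator (D w) x \<partial>M)"
    by (rule split) measurable
  moreover have "(\<integral>\<^sup>+x. G x * h x \<partial>M) = (\<Sum>w\<in>W j ` space M. \<integral>\<^sup>+x. G x * h x * indicator (D w) x \<partial>M)"
    by (rule split) measurable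
  ultimately show ?thesis by (simp only: sum_mono)
qed

section \<open>Grid cells of centres and points\<close>

lemma c_scaled: "c j x * real R ^ j * R = c j x * real R ^ Suc j"
  by simp

lemma c_step_scaled: "x \<in> space M \<Longrightarrow> \<bar>c (Suc j) x * real R ^ Suc j - c j x * real R ^ j * R\<bar> \<le> R"
proof -
  assume "x \<in> space M"
  then have "\<bar>c (Suc j) x - c j x\<bar> * real R ^ Suc j \<le> (1 / R) ^ j * real R ^ Suc j"
    by (intro mult_right_mono c_step) auto
  moreover have "(1 / R) ^ j * real R ^ Suc j = R"
    using R_pos by (simp add: field_simps)
  moreover have "\<bar>c (Suc j) x - c j x\<bar> * real R ^ Suc j = \<bar>c (Suc j) x * real R ^ Suc j - c j x * real R ^ j * R\<bar>"
    unfolding c_scaled left_diff_distrib[symmetric] by (simp add: abs_mult)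
  ultimately show ?thesis by linarith
qed

text \<open>Within an atom of stage \<open>j\<close> the next centre moves by at most
  \<open>R\<close> meshes of the finer grid. This is the source of the count
  \<open>2 * R + 1\<close>.\<close>

lemma cell_Suc_range:
  assumes "x \<in> space M" "y \<in> space M" "W j y = W j x"
  shows "cell (Suc j) y \<in> {\<lfloor>c j x * real R ^ j * R\<rfloor> - int R .. \<lfloor>c j x * real R ^ j * R\<rfloor> + int R}"
proof -
  have "\<bar>c (Suc j) y * real R ^ Suc j - c j x * real R ^ j * R\<bar> \<le> R"
    using c_step_scaled[OF assms(2), of j] c_cong[OF assms(2,1,3)] by simp
  then show ?thesis unfolding cell_def by (simp add: floor_le_iff le_floor_iff) linarith
qed

text \<open>The four predecessors: dividing the finer label by \<open>R\<close> locates the coarser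
  scaled centre up to an error 1 from the step and a further \<open>1 / R \<le> 1\<close> from the
  floor.\<close>

lemma cell_pred_range:
  assumes "x \<in> space M"
  shows "cell j x \<in> {\<lfloor>cell (Suc j) x / R\<rfloor> - 1 .. \<lfloor>cell (Suc j) x / R\<rfloor> + 2}"
proof -
  define z where "z = c (Suc j) x * real R ^ Suc j"
  have 1: "\<bar>z / R - c j x * real R ^ j\<bar> \<le> 1"
  proof -
    have "z / R - c j x * real R ^ j = (z - c j x * real R ^ j * R) / R"
      using R_pos by (simp add: field_simps)
    then show ?thesis
      using c_step_scaled[OF assms, of j] R_pos by (simp add: z_def)
  qed
  have "real_of_int \<lfloor>z\<rfloor> / R \<le> z / R" "z / R < (real_of_int \<lfloor>z\<rfloor> + 1) / R"
    using R_pos by (auto intro: divide_right_mono divide_strict_right_mono)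
  moreover have "(real_of_int \<lfloor>z\<rfloor> + 1) / R \<le> real_of_int \<lfloor>z\<rfloor> / R + 1"
    using R_pos by (simp add: add_divide_distrib)
  ultimately show ?thesis using 1 unfolding cell_def z_def[symmetric]
    by (simp add: floor_le_iff le_floor_iff) linarith
qed

lemma f_near_scaled: "x \<in> space M \<Longrightarrow> \<bar>f x * real R ^ j - c j x * real R ^ j\<bar> \<le> 1"
proof -
  assume "x \<in> space M"
  then have "\<bar>f x - c j x\<bar> * real R ^ j \<le> (1 / R) ^ j * real R ^ j"
    by (intro mult_right_mono f_near) auto
  moreover have "(1 / R) ^ j * real R ^ j = 1"
    using R_pos by (simp add: field_simps)
  moreover have "\<bar>f x - c j x\<bar> * real R ^ j = \<bar>f x * real R ^ j - c j x * real R ^ j\<bar>"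
    unfolding left_diff_distrib[symmetric] by (simp add: abs_mult)
  ultimately show ?thesis by simp
qed

lemma f_in_cell:
  assumes "x \<in> space M"
  shows "(of_int (cell j x) - 1) * (1 / R) ^ j \<le> f x \<and> f x < (of_int (cell j x) + 2) * (1 / R) ^ j"
proof -
  have "of_int (cell j x) - 1 \<le> f x * real R ^ j \<and> f x * real R ^ j < of_int (cell j x) + 2"
    using f_near_scaled[OF assms, of j] unfolding cell_def by linarith
  then show ?thesis using R_pos by (simp add: field_simps)
qed

text \<open>The scaled centre is less than 2 away from the scaled \<open>z\<close>: 1 from the ball,
  1 from \<open>f_near\<close>. These five labels are the factor 5 of the mass bound.\<close>

lemma cell_of_ball:
  assumes "x \<in> space M" "f x \<in> ball z ((1 / R) ^ j)"
  shows "cell j x \<in> {\<lfloor>z * real R ^ j\<rfloor> - 2 .. \<lfloor>z * real R ^ j\<rfloor> + 2}"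
proof -
  have "\<bar>z - f x\<bar> * real R ^ j < (1 / R) ^ j * real R ^ j"
    using assms(2) R_pos by (intro mult_strict_right_mono) (auto simp: dist_real_def)
  moreover have "(1 / R) ^ j * real R ^ j = 1"
    using R_pos by (simp add: field_simps)
  moreover have "\<bar>z - f x\<bar> * real R ^ j = \<bar>z * real R ^ j - f x * real R ^ j\<bar>"
    unfolding left_diff_distrib[symmetric] by (simp add: abs_mult)
  ultimately show ?thesis using f_near_scaled[OF assms(1), of j] unfolding cell_def
    by (simp add: floor_le_iff le_floor_iff) linarith
qed

lemma P_on_atom:
  assumes "y \<in> atom j x"
  shows "P j y = measure (cond j x) {z\<in>space M. cell (Suc j) z = cell (Suc j) y}"
  using assms cond_cong[of j y x] by (simp add: P_def atom_def)

lemma AE_cell_Suc_range: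
  assumes "x \<in> space M"
  shows "AE y in cond j x. cell (Suc j) y \<in>
    {\<lfloor>c j x * real R ^ j * R\<rfloor> - int R .. \<lfloor>c j x * real R ^ j * R\<rfloor> + int R}"
  using AE_cond_atom by eventually_elim (auto simp only: atom_def intro: cell_Suc_range assms)

section \<open>Exponential moments of the cell probabilities\<close>

lemma AE_P_pos: "AE x in M. \<forall>j. 0 < P j x"
proof (subst AE_all_countable, rule allI)
  fix j
  show "AE x in M. 0 < P j x"
  proof (rule AE_from_cond)
    fix x assume x: "x \<in> space M" "prob (atom j x) \<noteq> 0"
    interpret C: prob_space "cond j x" by (rule prob_space_cond) fact
    have "AE y in cond j x. 0 < C.prob {z \<in> space (cond j x). cell (Suc j) z = cell (Suc j) y}"
      by (rule C.AE_prob_fibre_pos[OF _ AE_cell_Suc_range[OF x(1)]]) auto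
    then show "AE y in cond j x. 0 < P j y"
      using AE_cond_atom by eventually_elim (simp add: P_on_atom)
  qed
qed

lemma nn_integral_P_powr_le:
  assumes "x \<in> space M" "prob (atom j x) \<noteq> 0" "0 < t"
  shows "(\<integral>\<^sup>+y. ennreal (P j y powr t) \<partial>cond j x)
    \<le> ennreal (exp (- t * (H j x - ln 3) + t\<^sup>2 * (2 * R + 1) / 2))"
proof -
  interpret C: prob_space "cond j x" by (rule prob_space_cond) fact
  have "(\<integral>\<^sup>+y. ennreal (P j y powr t) \<partial>cond j x)
      = (\<integral>\<^sup>+y. ennreal (C.prob {z \<in> space (cond j x). cell (Suc j) z = cell (Suc j) y} powr t) \<partial>cond j x)"
  proof (rule nn_integral_cong_AE)
    show "AE y in cond j x. ennreal (P j y powr t) =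
        ennreal (C.prob {z \<in> space (cond j x). cell (Suc j) z = cell (Suc j) y} powr t)"
      using AE_cond_atom by eventually_elim (simp add: P_on_atom)
  qed
  also have "\<dots> \<le> ennreal (exp (- t * (H j x - ln 3) + t\<^sup>2 *
      card {\<lfloor>c j x * real R ^ j * R\<rfloor> - int R .. \<lfloor>c j x * real R ^ j * R\<rfloor> + int R} / 2))"
    unfolding H_def
  proof (rule C.integral_prob_fibre_powr_le)
    show "AE y in cond j x. (of_int (cell (Suc j) y) - 1) * (1 / R) ^ Suc j \<le> f y \<and>
        f y < (of_int (cell (Suc j) y) + 2) * (1 / R) ^ Suc j"
      using AE_space by eventually_elim (rule f_in_cell, simp)
    show "AE y in cond j x. cell (Suc j) y \<in>
        {\<lfloor>c j x * real R ^ j * R\<rfloor> - int R .. \<lfloor>c j x * real R ^ j * R\<rfloor> + int R}"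
      by (rule AE_cell_Suc_range) fact
  qed (use R_pos assms in auto)
  finally show ?thesis by (simp add: algebra_simps)
qed

text \<open>The integrands form a non-negative supermartingale started at 1: the old factors and the
  new entropy are constant on the atoms of stage \<open>Suc n\<close>, and given such an atom the
  new factor has mean at most 1.\<close>

lemma nn_integral_prod_P_powr_le:
  assumes "0 < t"
  shows "(\<integral>\<^sup>+x. ennreal (\<Prod>j=1..n. P j x powr t * exp (t * (H j x - ln 3) - t\<^sup>2 * (2 * R + 1) / 2)) \<partial>M) \<le> 1"
proof (induction n)
  case 0
  then show ?case by (simp add: emeasure_space_1)
next
  case (Suc n)
  define V where "V n x = (\<Prod>j=1..n. P j x powr t * exp (t * (H j x - ln 3) - t\<^sup>2 * (2 * R + 1) / 2))" for n x
  define E where "E x = exp (t * (H (Suc n) x - ln 3) - t\<^sup>2 * (2 * R + 1) / 2)" for x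
  have V0: "0 \<le> V n x" for n x unfolding V_def by (intro prod_nonneg) auto
  have "(\<integral>\<^sup>+x. ennreal (V (Suc n) x) \<partial>M)
      = (\<integral>\<^sup>+x. ennreal (V n x * E x) * ennreal (P (Suc n) x powr t) \<partial>M)"
    using V0 by (intro nn_integral_cong) (simp add: V_def E_def mult_ac flip: ennreal_mult)
  also have "\<dots> \<le> (\<integral>\<^sup>+x. ennreal (V n x * E x) * ennreal (exp (- t * (H (Suc n) x - ln 3) + t\<^sup>2 * (2 * R + 1) / 2)) \<partial>M)"
  proof (rule nn_integral_cond_step[where j = "Suc n"])
    fix x y assume xy: "x \<in> space M" "y \<in> space M" "W (Suc n) x = W (Suc n) y"
    have "P j x = P j y" "H j x = H j y" if "j \<in> {1..n}" for j
      using refine_le[OF xy(1,2) _ xy(3), of "Suc j"] refine_le[OF xy(1,2) _ xy(3), of j] that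
      by (auto intro: P_cong[OF xy(1,2)] H_cong)
    then have "V n x = V n y" unfolding V_def by (intro prod.cong) simp_all
    moreover have "H (Suc n) x = H (Suc n) y" using xy by (intro H_cong)
    ultimately show "ennreal (V n x * E x) = ennreal (V n y * E y)"
      "ennreal (exp (- t * (H (Suc n) x - ln 3) + t\<^sup>2 * (2 * R + 1) / 2))
        = ennreal (exp (- t * (H (Suc n) y - ln 3) + t\<^sup>2 * (2 * R + 1) / 2))"
      by (simp_all add: E_def)
  next
    fix x assume "x \<in> space M" "prob (atom (Suc n) x) \<noteq> 0"
    then show "(\<integral>\<^sup>+y. ennreal (P (Suc n) y powr t) \<partial>cond (Suc n) x)
        \<le> ennreal (exp (- t * (H (Suc n) x - ln 3) + t\<^sup>2 * (2 * R + 1) / 2))"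
      using assms by (rule nn_integral_P_powr_le)
  qed measurable
  also have "\<dots> = (\<integral>\<^sup>+x. ennreal (V n x) \<partial>M)"
  proof (rule nn_integral_cong)
    fix x
    have "E x * exp (- t * (H (Suc n) x - ln 3) + t\<^sup>2 * (2 * R + 1) / 2) = 1"
      unfolding E_def by (simp flip: exp_add)
    then show "ennreal (V n x * E x) * ennreal (exp (- t * (H (Suc n) x - ln 3) + t\<^sup>2 * (2 * R + 1) / 2)) = ennreal (V n x)"
      using V0[of n x] by (simp add: E_def mult.assoc flip: ennreal_mult)
  qed
  also have "\<dots> \<le> 1" using Suc unfolding V_def .
  finally show ?case unfolding V_def .
qed

lemma AE_sum_ln_P_ge:
  "AE x in M. \<forall>\<^sub>F n in sequentially.
     (\<Sum>j=1..n. H j x - ln 3) - real n \<le> - (\<Sum>j=1..n. ln (P j x))"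
proof -
  \<comment> \<open>With this \<open>t\<close> the second-order term costs
    \<open>\<eta> = t / 2\<close> per stage, while the slack \<open>real n\<close> in
    \<open>bad\<close> gains \<open>t\<close> per stage. Markov's inequality is left with
    \<open>exp (- \<eta> * n)\<close>, which is summable.\<close>
  define t where "t = 1 / (2 * real R + 1)"
  define \<eta> where "\<eta> = t / 2"
  have t: "0 < t" "t\<^sup>2 * (2 * R + 1) = t"
  proof -
    have "0 < 2 * real R + 1" by (simp add: add_nonneg_pos)
    then show "0 < t" "t\<^sup>2 * (2 * R + 1) = t"
      by (simp_all add: t_def power2_eq_square add.commute)
  qed
  \<comment> \<open>Positivity is part of the event because \<open>ln 0 = 0\<close> would break the
    passage from the product of powers to the exponential of a sum.\<close>
  define bad where "bad n = {x\<in>space M. (\<forall>j\<in>{1..n}. 0 < P j x) \<and>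
      - (\<Sum>j=1..n. ln (P j x)) < (\<Sum>j=1..n. H j x - ln 3) - real n}" for n
  have bad[measurable]: "bad n \<in> sets M" for n unfolding bad_def by measurable
  define V where "V n x = (\<Prod>j=1..n. P j x powr t * exp (t * (H j x - ln 3) - t\<^sup>2 * (2 * R + 1) / 2))" for n x
  have [measurable]: "V n \<in> borel_measurable M" for n unfolding V_def by measurable
  have prob_bad: "prob (bad n) \<le> exp (- \<eta>) ^ n" for n
  proof -
    have le: "ennreal (exp (\<eta> * n)) * indicator (bad n) x \<le> ennreal (V n x)" for x
    proof (cases "x \<in> bad n")
      case True
      have "V n x = (\<Prod>j=1..n. exp (t * (ln (P j x) + (H j x - ln 3)) - \<eta>))"
        unfolding V_def
      proof (rule prod.cong)
        fix j assume "j \<in> {1..n}"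
        then have "0 < P j x" using True by (auto simp: bad_def)
        then show "P j x powr t * exp (t * (H j x - ln 3) - t\<^sup>2 * (2 * R + 1) / 2)
            = exp (t * (ln (P j x) + (H j x - ln 3)) - \<eta>)"
          unfolding t(2) by (simp add: powr_def \<eta>_def algebra_simps flip: exp_add)
      qed simp
      also have "\<dots> = exp (\<Sum>j=1..n. t * (ln (P j x) + (H j x - ln 3)) - \<eta>)"
        by (simp add: exp_sum)
      also have "(\<Sum>j=1..n. t * (ln (P j x) + (H j x - ln 3)) - \<eta>)
          = t * ((\<Sum>j=1..n. ln (P j x)) + (\<Sum>j=1..n. H j x - ln 3)) - \<eta> * n"
        by (simp add: sum_subtractf sum.distrib flip: sum_distrib_left)
      finally have V: "V n x = exp (t * ((\<Sum>j=1..n. ln (P j x)) + (\<Sum>j=1..n. H j x - ln 3)) - \<eta> * n)" .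
      have "t * real n \<le> t * ((\<Sum>j=1..n. ln (P j x)) + (\<Sum>j=1..n. H j x - ln 3))"
        using True t by (intro mult_left_mono) (auto simp: bad_def)
      then have "exp (\<eta> * n) \<le> V n x" unfolding V by (simp add: \<eta>_def)
      then show ?thesis using True by (simp add: ennreal_leI)
    qed simp
    have "ennreal (exp (\<eta> * n)) * emeasure M (bad n)
        = (\<integral>\<^sup>+x. ennreal (exp (\<eta> * n)) * indicator (bad n) x \<partial>M)"
      by (simp add: nn_integral_cmult_indicator)
    also have "\<dots> \<le> (\<integral>\<^sup>+x. ennreal (V n x) \<partial>M)"
      by (intro nn_integral_mono le)
    also have "\<dots> \<le> 1"
      unfolding V_def using t(1) by (rule nn_integral_prod_P_powr_le)
    finally have "exp (\<eta> * n) * prob (bad n) \<le> 1"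
      by (simp add: emeasure_eq_measure flip: ennreal_mult ennreal_1)
    then show ?thesis
      by (simp add: exp_minus field_simps flip: exp_of_nat_mult)
  qed
  have "summable (\<lambda>n. exp (- \<eta>) ^ n)"
    using t by (intro summable_geometric) (simp add: \<eta>_def)
  then have "summable (\<lambda>n. prob (bad n))"
    by (rule summable_comparison_test') (use prob_bad in auto)
  from borel_cantelli_AE1[OF bad _ this]
  have "AE x in M. \<forall>\<^sub>F n in sequentially. x \<in> space M - bad n"
    by (simp add: emeasure_eq_measure)
  with AE_P_pos show ?thesis
  proof eventually_elim
    case (elim x)
    show ?case using elim(2) by eventually_elim (use elim(1) in \<open>auto simp: bad_def not_less\<close>)
  qed
qed

text \<open>Given the atom of stage \<open>Suc n\<close>, the factor \<open>1 / P (Suc n)\<close>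
  integrates over a cell of the next stage to at most 1, and to 0 unless the present cell is one of
  the four possible predecessors. Each stage thus multiplies the bound by 4, even if the images of
  many words overlap in the cell.\<close>

lemma nn_integral_cell_inverse_q_le:
  "(\<integral>\<^sup>+x. indicator {x\<in>space M. cell (Suc n) x = k} x * ennreal (1 / q n x) \<partial>M) \<le> 4 ^ n"
proof (induction n arbitrary: k)
  case 0
  have "(\<integral>\<^sup>+x. indicator {x\<in>space M. cell (Suc 0) x = k} x * ennreal (1 / q 0 x) \<partial>M)
      \<le> (\<integral>\<^sup>+x. 1 \<partial>M)"
    by (intro nn_integral_mono) (simp add: q_def split: split_indicator)
  then show ?case by (simp add: emeasure_space_1)
next
  case (Suc n)
  define N where "N = {\<lfloor>k / R\<rfloor> - 1 .. \<lfloor>k / R\<rfloor> + 2}"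
  define S where "S i = {x\<in>space M. cell (Suc n) x = i}" for i
  define S' where "S' = {x\<in>space M. cell (Suc (Suc n)) x = k}"
  have q0: "0 \<le> q n x" for n x unfolding q_def P_def by (intro prod_nonneg) auto
  have P0: "0 \<le> P n x" for n x unfolding P_def by auto
  have "(\<integral>\<^sup>+x. indicator S' x * ennreal (1 / q (Suc n) x) \<partial>M)
      = (\<integral>\<^sup>+x. ennreal (1 / q n x) * (indicator S' x * ennreal (1 / P (Suc n) x)) \<partial>M)"
    using q0 P0 by (intro nn_integral_cong)
      (simp add: q_def mult_ac split: split_indicator flip: ennreal_mult)
  also have "\<dots> \<le> (\<integral>\<^sup>+x. ennreal (1 / q n x) * (\<Sum>i\<in>N. indicator (S i) x) \<partial>M)"
  proof (rule nn_integral_cond_step[where j = "Suc n"])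
    fix x y assume xy: "x \<in> space M" "y \<in> space M" "W (Suc n) x = W (Suc n) y"
    show "ennreal (1 / q n x) = ennreal (1 / q n y)" using q_cong[OF xy] by simp
    show "(\<Sum>i\<in>N. indicator (S i) x) = (\<Sum>i\<in>N. indicator (S i) y :: ennreal)"
      using cell_cong[OF xy] xy by (simp add: S_def indicator_def)
  next
    show "(\<lambda>x. indicator S' x * ennreal (1 / P (Suc n) x)) \<in> borel_measurable M"
      unfolding S'_def by measurable
  next
    fix x assume x: "x \<in> space M" "prob (atom (Suc n) x) \<noteq> 0"
    interpret C: prob_space "cond (Suc n) x" by (rule prob_space_cond) fact
    show "(\<integral>\<^sup>+y. indicator S' y * ennreal (1 / P (Suc n) y) \<partial>cond (Suc n) x) \<le> (\<Sum>i\<in>N. indicator (S i) x)"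
    proof (cases "cell (Suc n) x \<in> N")
      case False
      have "(\<integral>\<^sup>+y. indicator S' y * ennreal (1 / P (Suc n) y) \<partial>cond (Suc n) x) = (\<integral>\<^sup>+y. 0 \<partial>cond (Suc n) x)"
      proof (rule nn_integral_cong_AE)
        show "AE y in cond (Suc n) x. indicator S' y * ennreal (1 / P (Suc n) y) = 0"
          using AE_cond_atom
        proof eventually_elim
          case (elim y)
          then have y: "y \<in> space M" "W (Suc n) y = W (Suc n) x" by (auto simp: atom_def)
          have "cell (Suc n) y \<notin> N" using cell_cong[OF y(1) x(1) y(2)] False by simp
          then have "y \<notin> S'" using cell_pred_range[OF y(1), of "Suc n"] by (auto simp: S'_def N_def)
          then show ?case by simp
        qed
      qed
      then show ?thesis by simp
    next
      case True
      define p where "p = C.prob S'"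
      have "(\<integral>\<^sup>+y. indicator S' y * ennreal (1 / P (Suc n) y) \<partial>cond (Suc n) x)
          = (\<integral>\<^sup>+y. ennreal (1 / p) * indicator S' y \<partial>cond (Suc n) x)"
      proof (rule nn_integral_cong_AE)
        show "AE y in cond (Suc n) x. indicator S' y * ennreal (1 / P (Suc n) y) = ennreal (1 / p) * indicator S' y"
          using AE_cond_atom
        proof eventually_elim
          case (elim y)
          then have "P (Suc n) y = p" if "y \<in> S'"
            using that P_on_atom[OF elim] by (simp add: p_def S'_def)
          then show ?case by (simp split: split_indicator)
        qed
      qed
      also have "\<dots> = ennreal (1 / p) * emeasure (cond (Suc n) x) S'"
        by (rule nn_integral_cmult_indicator) (simp add: S'_def)
      also have "\<dots> \<le> 1"
        unfolding C.emeasure_eq_measure p_def[symmetric]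
        by (subst ennreal_mult[symmetric]) (auto simp: p_def)
      also have "1 = (indicator (S (cell (Suc n) x)) x :: ennreal)"
        using x by (simp add: S_def)
      also have "\<dots> \<le> (\<Sum>i\<in>N. indicator (S i) x)"
        using True by (intro member_le_sum) (auto simp: N_def)
      finally show ?thesis .
    qed
  qed
  also have "\<dots> = (\<Sum>i\<in>N. \<integral>\<^sup>+x. indicator (S i) x * ennreal (1 / q n x) \<partial>M)"
    unfolding sum_distrib_left S_def by (subst nn_integral_sum) (auto simp: mult.commute)
  also have "\<dots> \<le> (\<Sum>i\<in>N. 4 ^ n)"
    using Suc by (intro sum_mono) (auto simp: S_def)
  also have "\<dots> = 4 ^ Suc n" by (simp add: N_def)
  finally show ?case unfolding S'_def .
qed

text \<open>Almost every point with large entropy sums has small \<open>q n\<close> from some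
  \<open>n0\<close> on, so it lies in a set \<open>E n0\<close> described by \<open>P\<close> and
  \<open>q\<close>. If all these countably many sets were null, the points with large entropy sums
  would be null too.\<close>

theorem exists_regular_subset:
  assumes "\<not> (AE x in M. \<not> (\<forall>\<^sub>F n in sequentially. real n * h \<le> (\<Sum>j=1..n. H j x)))"
  shows "\<exists>E n0. E \<in> sets M \<and> 0 < prob E \<and> (\<forall>n\<ge>n0. \<forall>z.
    prob {x\<in>E. f x \<in> ball z ((1 / R) ^ Suc n)} \<le> 5 * exp (- real n * (h - ln 12 - 1)))"
proof -
  define E where "E n0 = {x\<in>space M. (\<forall>j. 0 < P j x) \<and> (\<forall>n\<in>{n0..}. q n x \<le> exp (- real n * (h - ln 3 - 1)))}" for n0
  have E[measurable]: "E n0 \<in> sets M" for n0 unfolding E_def by measurable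
  have "\<exists>n0. 0 < prob (E n0)"
  proof (rule ccontr)
    assume "\<not> ?thesis"
    then have "prob (E n0) = 0" for n0 by (metis measure_nonneg order_le_less)
    then have "E n0 \<in> null_sets M" for n0 by (auto simp: null_sets_def emeasure_eq_measure)
    then have "AE x in M. \<forall>n0. x \<notin> E n0" by (subst AE_all_countable) (auto intro: AE_not_in)
    then have "AE x in M. \<not> (\<forall>\<^sub>F n in sequentially. real n * h \<le> (\<Sum>j=1..n. H j x))"
      using AE_sum_ln_P_ge AE_P_pos AE_space
    proof eventually_elim
      case (elim x)
      show ?case
      proof
        assume "\<forall>\<^sub>F n in sequentially. real n * h \<le> (\<Sum>j=1..n. H j x)"
        with elim(2) have "\<forall>\<^sub>F n in sequentially. q n x \<le> exp (- real n * (h - ln 3 - 1))"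
        proof eventually_elim
          case (elim n)
          have "q n x = exp (\<Sum>j=1..n. ln (P j x))"
            unfolding q_def using \<open>\<forall>j. 0 < P j x\<close> by (simp add: exp_sum)
          also have "\<dots> \<le> exp (- real n * (h - ln 3 - 1))"
            using elim by (simp add: sum_subtractf algebra_simps)
          finally show ?case .
        qed
        then obtain n0 where "\<forall>n\<ge>n0. q n x \<le> exp (- real n * (h - ln 3 - 1))"
          by (auto simp: eventually_sequentially)
        then have "x \<in> E n0" using elim by (auto simp: E_def)
        with elim show False by blast
      qed
    qed
    with assms show False by blast
  qed
  then obtain n0 where n0: "0 < prob (E n0)" by blast
  have "prob {x\<in>E n0. f x \<in> ball z ((1 / R) ^ Suc n)} \<le> 5 * exp (- real n * (h - ln 12 - 1))"
    if n: "n \<ge> n0" for n z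
  proof -
    define B where "B = {x\<in>E n0. f x \<in> ball z ((1 / R) ^ Suc n)}"
    define N where "N = {\<lfloor>z * real R ^ Suc n\<rfloor> - 2 .. \<lfloor>z * real R ^ Suc n\<rfloor> + 2}"
    define e where "e = exp (- real n * (h - ln 3 - 1))"
    define S where "S i = {x\<in>space M. cell (Suc n) x = i}" for i
    have "B = E n0 \<inter> (f -` ball z ((1 / R) ^ Suc n) \<inter> space M)"
      by (auto simp: B_def E_def)
    then have [measurable]: "B \<in> sets M" using f_meas by (auto intro!: measurable_sets)
    have "emeasure M B = (\<integral>\<^sup>+x. indicator B x \<partial>M)" by simp
    \<comment> \<open>On \<open>E n0\<close> one has \<open>1 \<le> e / q n x\<close>, which turns
      mass into the integral of \<open>1 / q n\<close> over the five cells that meet the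
      ball.\<close>
    also have "\<dots> \<le> (\<integral>\<^sup>+x. ennreal e * (\<Sum>i\<in>N. indicator (S i) x * ennreal (1 / q n x)) \<partial>M)"
    proof (rule nn_integral_mono)
      fix x assume x: "x \<in> space M"
      show "indicator B x \<le> ennreal e * (\<Sum>i\<in>N. indicator (S i) x * ennreal (1 / q n x))"
      proof (cases "x \<in> B")
        case True
        then have xE: "x \<in> E n0" and "f x \<in> ball z ((1 / R) ^ Suc n)"
          unfolding B_def by blast+
        then have "cell (Suc n) x \<in> N"
          unfolding N_def by (intro cell_of_ball x)
        have q: "0 < q n x" "q n x \<le> e"
          using xE n unfolding E_def q_def e_def by (auto intro!: prod_pos)
        have "indicator B x \<le> ennreal (e * (1 / q n x))"
          using q True by (simp add: field_simps flip: ennreal_1)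
        also have "\<dots> = ennreal e * (indicator (S (cell (Suc n) x)) x * ennreal (1 / q n x))"
          using q x by (simp add: S_def e_def flip: ennreal_mult)
        also have "\<dots> \<le> ennreal e * (\<Sum>i\<in>N. indicator (S i) x * ennreal (1 / q n x))"
          using \<open>cell (Suc n) x \<in> N\<close>
          by (intro mult_left_mono member_le_sum[where f = "\<lambda>i. indicator (S i) x * ennreal (1 / q n x)"])
            (auto simp: N_def)
        finally show ?thesis .
      qed simp
    qed
    also have "\<dots> = ennreal e * (\<Sum>i\<in>N. \<integral>\<^sup>+x. indicator (S i) x * ennreal (1 / q n x) \<partial>M)"
      unfolding S_def by (simp add: nn_integral_cmult nn_integral_sum)
    also have "\<dots> \<le> ennreal e * (\<Sum>i\<in>N. 4 ^ n)"
      unfolding S_def by (intro mult_left_mono sum_mono nn_integral_cell_inverse_q_le) simp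
    also have "\<dots> = ennreal (e * (5 * 4 ^ n))"
      by (simp add: N_def e_def ennreal_mult flip: ennreal_power ennreal_numeral)
    finally have "prob B \<le> e * (5 * 4 ^ n)"
      by (simp add: emeasure_eq_measure e_def)
    also have "4 ^ n = exp (real n * ln 4)" by (simp add: exp_of_nat_mult)
    also have "e * (5 * exp (real n * ln 4)) = 5 * exp (- real n * (h - (ln 3 + ln 4) - 1))"
      unfolding e_def by (simp add: algebra_simps flip: exp_add)
    also have "ln 3 + ln 4 = ln (12 :: real)" using ln_mult[of "3 :: real" 4] by simp
    finally show ?thesis unfolding B_def .
  qed
  with n0 E show ?thesis by blast
qed

end

section \<open>Hausdorff dimension on the line\<close>

text \<open>The covering intervals have lengths \<open>e / (i + 1)\<close>: their sum diverges, so they exhaust the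
  line, while the sum of squares is a small multiple of \<open>e\<^sup>2\<close>.\<close>

lemma hausdorff_measure_2_eq_0: "hausdorff_measure 2 (U :: real set) = 0"
proof -
  have small: "hausdorff_delta 2 \<delta> U \<le> ennreal (4 * e\<^sup>2 * (pi\<^sup>2 / 6))" if e: "0 < e" "e \<le> \<delta>" for \<delta> e
  proof -
    define I where "I i = {e * harm i .. e * harm (Suc i)}" for i
    \<comment> \<open>Even indices cover the non-negative half-line, odd indices its mirror
      image.\<close>
    define C where "C j = (if even j then I (j div 2) else uminus ` I (j div 2))" for j
    have I_le: "e * harm i \<le> e * harm (Suc i)" for i
      using e by (simp add: harm_Suc)
    have diam: "diameter (C j) = e / real (Suc (j div 2))" for j
      using I_le[of "j div 2"] by (simp add: C_def I_def) (simp add: harm_Suc field_simps)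
    have "U \<subseteq> (\<Union>j. C j)"
    proof
      fix x
      have "\<exists>i. \<bar>x\<bar> \<in> I i"
      proof -
        have "\<exists>n. \<bar>x\<bar> / e \<le> harm n"
          using harm_at_top by (auto simp: filterlim_at_top eventually_sequentially)
        then have ex: "\<exists>n. \<bar>x\<bar> \<le> e * harm n" using e by (simp add: field_simps)
        define n where "n = (LEAST n. \<bar>x\<bar> \<le> e * harm n)"
        have n: "\<bar>x\<bar> \<le> e * harm n" unfolding n_def using ex by (rule LeastI_ex)
        show ?thesis
        proof (cases n)
          case 0
          then have "\<bar>x\<bar> \<in> I 0" using n e by (simp add: I_def harm_expand harm_Suc)
          then show ?thesis ..
        next
          case (Suc i)
          then have "\<not> \<bar>x\<bar> \<le> e * harm i"
            unfolding n_def by (metis lessI not_less_Least)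
          then have "\<bar>x\<bar> \<in> I i" using n Suc by (simp add: I_def)
          then show ?thesis ..
        qed
      qed
      then obtain i where i: "\<bar>x\<bar> \<in> I i" ..
      then have "x \<in> C (if 0 \<le> x then 2 * i else 2 * i + 1)"
        by (auto simp: C_def intro: image_eqI[of _ _ "- x"])
      then show "x \<in> (\<Union>j. C j)" by blast
    qed
    moreover have "bounded (C j)" for j
      unfolding C_def I_def by (auto intro: bounded_uminus)
    moreover have "diameter (C j) \<le> \<delta>" for j
    proof -
      have "e / real (Suc (j div 2)) \<le> e" using e by (simp add: divide_le_eq)
      then show ?thesis using e by (simp add: diam)
    qed
    ultimately have "hausdorff_delta 2 \<delta> U \<le> (\<Sum>j. ennreal (diameter (C j) powr 2))"
      unfolding hausdorff_delta_def by (intro INF_lower) auto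
    also have "\<dots> \<le> (\<Sum>j. ennreal (4 * e\<^sup>2 * (1 / real (j + 1) ^ 2)))"
    proof (intro suminf_le ennreal_leI)
      fix j
      have "j + 1 \<le> 2 * Suc (j div 2)" by presburger
      then have "real (j + 1) \<le> 2 * real (Suc (j div 2))"
        unfolding of_nat_le_iff[symmetric, where 'a = real] by simp
      then have "diameter (C j) \<le> 2 * e / real (j + 1)"
      proof -
        have "diameter (C j) = 2 * e / (2 * real (Suc (j div 2)))" by (simp add: diam del: of_nat_Suc)
        also have "\<dots> \<le> 2 * e / real (j + 1)"
          using e \<open>real (j + 1) \<le> 2 * real (Suc (j div 2))\<close> by (intro frac_le) auto
        finally show ?thesis .
      qed
      moreover have d0: "0 < diameter (C j)" using e by (simp add: diam)
      ultimately have "(diameter (C j))\<^sup>2 \<le> (2 * e / real (j + 1))\<^sup>2"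
        by (intro power_mono) auto
      then show "diameter (C j) powr 2 \<le> 4 * e\<^sup>2 * (1 / real (j + 1) ^ 2)"
        using d0 by (simp add: power_divide power_mult_distrib)
    qed auto
    also have "\<dots> = ennreal (4 * e\<^sup>2 * (pi\<^sup>2 / 6))"
      using sums_mult[OF inverse_squares_sums, of "4 * e\<^sup>2"]
      by (intro suminf_ennreal_eq) (auto simp: add.commute)
    finally show ?thesis .
  qed
  have "hausdorff_delta 2 \<delta> U = 0" if "0 < \<delta>" for \<delta>
  proof -
    have "((\<lambda>e. ennreal (4 * e\<^sup>2 * (pi\<^sup>2 / 6))) \<longlongrightarrow> ennreal (4 * 0\<^sup>2 * (pi\<^sup>2 / 6))) (at_right 0)"
      by (intro tendsto_intros)
    moreover have "\<forall>\<^sub>F e in at_right 0. hausdorff_delta 2 \<delta> U \<le> ennreal (4 * e\<^sup>2 * (pi\<^sup>2 / 6))"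
      using eventually_at_right_less[of 0] eventually_at_right_field that small
      by (auto simp: eventually_at_right_field intro!: exI[of _ \<delta>])
    ultimately have "hausdorff_delta 2 \<delta> U \<le> ennreal (4 * 0\<^sup>2 * (pi\<^sup>2 / 6))"
      by (intro tendsto_lowerbound) auto
    then show ?thesis by simp
  qed
  then show ?thesis unfolding hausdorff_measure_def by simp
qed

text \<open>A lower bound on an infimum of reals needs a non-empty set of exponents; the exponent 2
  always belongs to it.\<close>

lemma hausdorff_dim_ge:
  fixes U :: "real set"
  assumes "\<And>t. 0 < t \<Longrightarrow> t < s \<Longrightarrow> hausdorff_measure t U \<noteq> 0"
  shows "s \<le> hausdorff_dim U"
  unfolding hausdorff_dim_def
proof (rule cInf_greatest)
  show "{s. 0 < s \<and> hausdorff_measure s U = 0} \<noteq> {}"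
    using hausdorff_measure_2_eq_0[of U] by (auto intro!: exI[of _ 2])
qed (use assms not_le in blast)

lemma hausdorff_dim_nonneg: "0 \<le> hausdorff_dim (U :: real set)"
  by (rule hausdorff_dim_ge) auto

lemma hausdorff_dim_measure_ge:
  assumes "\<And>U. U \<in> sets borel \<Longrightarrow> emeasure \<nu> (UNIV - U) = 0 \<Longrightarrow> s \<le> hausdorff_dim U"
  shows "s \<le> hausdorff_dim_measure \<nu>"
  unfolding hausdorff_dim_measure_def
proof (rule cInf_greatest)
  show "{hausdorff_dim U |U. U \<in> sets borel \<and> emeasure \<nu> (UNIV - U) = 0} \<noteq> {}"
    by (auto intro!: exI[of _ UNIV])
qed (use assms in blast)

text \<open>Only a part \<open>E\<close> of the measure needs to satisfy the Frostman bound, because a set of full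
  measure still carries all of \<open>E\<close>.\<close>

lemma (in prob_space) mass_distribution:
  fixes f :: "'a \<Rightarrow> real" and R :: nat
  assumes f[measurable]: "f \<in> borel_measurable M" and E[measurable]: "E \<in> sets M" and posE: "0 < prob E"
    and R: "2 \<le> R" and K: "0 < K"
    and ball: "\<And>n z. n0 \<le> n \<Longrightarrow> prob {x\<in>E. f x \<in> ball z ((1 / R) ^ Suc n)} \<le> K * ((1 / R) ^ n) powr s"
  shows "s \<le> hausdorff_dim_measure (distr M borel f)"
proof (intro hausdorff_dim_measure_ge hausdorff_dim_ge)
  fix U t assume U[measurable]: "U \<in> sets borel" and null: "emeasure (distr M borel f) (UNIV - U) = 0"
    and t: "0 < t" "t < s"
  define \<rho> where "\<rho> = 1 / real R"
  have \<rho>: "0 < \<rho>" "\<rho> < 1" using R by (auto simp: \<rho>_def)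
  \<comment> \<open>If \<open>\<rho> ^ m\<close> is the first power not exceeding \<open>r\<close>,
    then \<open>r < \<rho> ^ (m - 1)\<close>, which is the radius of the ball at stage
    \<open>n = m - 2\<close>. The two lost stages cost \<open>\<rho> powr (- 2 * s)\<close>, and the
    restriction on \<open>r\<close> ensures \<open>n0 \<le> n\<close>.\<close>
  define K' where "K' = K * \<rho> powr (- 2 * s)"
  have K': "0 < K'" using K \<rho> by (simp add: K'_def)
  have piece: "prob {x\<in>E. f x \<in> cball z r} \<le> K' * r powr t" if r: "0 \<le> r" "r \<le> \<rho> ^ (n0 + 2)" for z r
  proof (cases "r = 0")
    case False
    define m where "m = (LEAST m. \<rho> ^ m \<le> r)"
    have m: "\<rho> ^ m \<le> r" "\<And>i. i < m \<Longrightarrow> r < \<rho> ^ i"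
    proof -
      have "\<exists>m. \<rho> ^ m \<le> r"
        using real_arch_pow_inv[of r \<rho>] \<rho> r False by (auto intro: less_imp_le)
      then show "\<rho> ^ m \<le> r" unfolding m_def by (rule LeastI_ex)
      show "r < \<rho> ^ i" if "i < m" for i
        using not_less_Least[OF that[unfolded m_def]] by simp
    qed
    have "n0 + 2 \<le> m"
    proof (rule ccontr)
      assume "\<not> ?thesis"
      then have "\<rho> ^ (n0 + 2) < \<rho> ^ m" using \<rho> by (intro power_strict_decreasing) auto
      with m r show False by simp
    qed
    then obtain n where n: "m = n + 2" "n0 \<le> n" by (metis add_le_imp_le_right le_add_diff_inverse2 le_trans le_add2)
    have "{x\<in>E. f x \<in> ball z (\<rho> ^ Suc n)} = E \<inter> (f -` ball z (\<rho> ^ Suc n) \<inter> space M)"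
      using sets.sets_into_space[OF E] by auto
    then have [measurable]: "{x\<in>E. f x \<in> ball z (\<rho> ^ Suc n)} \<in> sets M"
      using f E by (auto intro!: measurable_sets)
    have "prob {x\<in>E. f x \<in> cball z r} \<le> prob {x\<in>E. f x \<in> ball z (\<rho> ^ Suc n)}"
      using m(2)[of "Suc n"] n by (intro finite_measure_mono) auto
    also have "\<dots> \<le> K * (\<rho> ^ n) powr s" using ball[OF n(2)] unfolding \<rho>_def .
    also have "(\<rho> ^ n) powr s = \<rho> powr (- 2 * s) * (\<rho> ^ m) powr s"
    proof -
      have "\<rho> ^ n = \<rho> powr real n" "\<rho> ^ m = \<rho> powr real m"
        using \<rho> by (simp_all add: powr_realpow)
      then show ?thesis by (simp add: n powr_powr algebra_simps flip: powr_add)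
    qed
    also have "K * (\<rho> powr (- 2 * s) * (\<rho> ^ m) powr s) \<le> K * (\<rho> powr (- 2 * s) * r powr t)"
    proof (intro mult_left_mono)
      have "\<rho> ^ (n0 + 2) \<le> 1" using \<rho> by (intro power_le_one) auto
      then have "r \<le> 1" using r by simp
      have "(\<rho> ^ m) powr s \<le> r powr s" using m(1) \<rho> t by (intro powr_mono2) auto
      also have "\<dots> \<le> r powr t" using t \<open>r \<le> 1\<close> r by (intro powr_mono') auto
      finally show "(\<rho> ^ m) powr s \<le> r powr t" .
    qed (use K in auto)
    finally show ?thesis by (simp add: K'_def mult.assoc)
  next
    \<comment> \<open>A covering set of diameter 0 contributes \<open>0 powr t = 0\<close>, so
      single points must have no mass in \<open>E\<close>; the ball bound gives this as
      \<open>n\<close> tends to infinity.\<close>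
    case True
    have "prob {x\<in>E. f x \<in> cball z r} \<le> K * ((\<rho> powr s) ^ n)" if "n0 \<le> n" for n
    proof -
      have "{x\<in>E. f x \<in> ball z (\<rho> ^ Suc n)} = E \<inter> (f -` ball z (\<rho> ^ Suc n) \<inter> space M)"
        using sets.sets_into_space[OF E] by auto
      then have [measurable]: "{x\<in>E. f x \<in> ball z (\<rho> ^ Suc n)} \<in> sets M"
        using f E by (auto intro!: measurable_sets)
      have "0 < \<rho> ^ Suc n" using \<rho> by simp
      then have "prob {x\<in>E. f x \<in> cball z r} \<le> prob {x\<in>E. f x \<in> ball z (\<rho> ^ Suc n)}"
        using True by (intro finite_measure_mono) (auto simp del: power_Suc)
      also have "\<dots> \<le> K * (\<rho> ^ n) powr s" using ball[OF that] unfolding \<rho>_def .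
      also have "(\<rho> ^ n) powr s = (\<rho> powr s) ^ n"
        using \<rho> by (simp add: powr_realpow[symmetric] powr_powr mult.commute)
      finally show ?thesis .
    qed
    moreover have "(\<lambda>n. K * ((\<rho> powr s) ^ n)) \<longlonglongrightarrow> K * 0"
    proof (intro tendsto_intros LIMSEQ_power_zero)
      have "\<rho> powr s < \<rho> powr 0" using \<rho> t by (intro powr_less_mono') auto
      then show "norm (\<rho> powr s) < 1" using \<rho> by simp
    qed
    ultimately have "prob {x\<in>E. f x \<in> cball z r} \<le> K * 0"
      by (intro LIMSEQ_le_const) auto
    then show ?thesis using True by simp
  qed
  have "ennreal (prob E / K') \<le> hausdorff_delta t (\<rho> ^ (n0 + 2)) U"
    unfolding hausdorff_delta_def
  proof (rule INF_greatest, clarify)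
    fix C :: "nat \<Rightarrow> real set"
    assume C: "\<forall>i. bounded (C i) \<and> diameter (C i) \<le> \<rho> ^ (n0 + 2)" and cover: "U \<subseteq> (\<Union>i. C i)"
    define z where "z i = (SOME x. x \<in> C i)" for i
    have sub: "C i \<subseteq> cball (z i) (diameter (C i))" for i
    proof
      fix x assume x: "x \<in> C i"
      then have "z i \<in> C i" unfolding z_def by (rule someI)
      then show "x \<in> cball (z i) (diameter (C i))"
        using diameter_bounded_bound[of "C i" "z i" x] C x by simp
    qed
    define B where "B i = {x\<in>E. f x \<in> cball (z i) (diameter (C i))}" for i
    have "B i = E \<inter> (f -` cball (z i) (diameter (C i)) \<inter> space M)" for i
      using sets.sets_into_space[OF E] by (auto simp: B_def)
    then have [measurable]: "B i \<in> sets M" for i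
      using f E by (auto intro!: measurable_sets)
    have "AE x in M. f x \<in> U"
    proof -
      have "f -` (UNIV - U) \<inter> space M \<in> null_sets M"
        using null by (auto simp: null_sets_def emeasure_distr)
      from AE_not_in[OF this] show ?thesis using AE_space by eventually_elim auto
    qed
    then have "AE x in M. x \<in> E \<longrightarrow> x \<in> (\<Union>i. B i)"
    proof eventually_elim
      case (elim x)
      then obtain i where "f x \<in> C i" using cover by blast
      then show ?case using subsetD[OF sub, of "f x" i] by (auto simp: B_def)
    qed
    then have "emeasure M E \<le> emeasure M (\<Union>i. B i)"
      by (intro emeasure_mono_AE) auto
    also have "\<dots> \<le> (\<Sum>i. emeasure M (B i))"
      by (intro emeasure_subadditive_countably) auto
    also have "\<dots> \<le> (\<Sum>i. ennreal K' * ennreal (diameter (C i) powr t))"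
    proof (intro suminf_le)
      fix i
      have "prob (B i) \<le> K' * diameter (C i) powr t"
        unfolding B_def by (rule piece) (use C in \<open>auto simp: diameter_ge_0\<close>)
      then show "emeasure M (B i) \<le> ennreal K' * ennreal (diameter (C i) powr t)"
        using K' by (simp add: emeasure_eq_measure ennreal_leI flip: ennreal_mult)
    qed auto
    also have "\<dots> = ennreal K' * (\<Sum>i. ennreal (diameter (C i) powr t))" by simp
    finally have le: "ennreal (prob E) \<le> ennreal K' * (\<Sum>i. ennreal (diameter (C i) powr t))"
      by (simp add: emeasure_eq_measure)
    have "ennreal (prob E / K') = ennreal (1 / K') * ennreal (prob E)"
      using K' by (simp flip: ennreal_mult)
    also have "\<dots> \<le> ennreal (1 / K') * (ennreal K' * (\<Sum>i. ennreal (diameter (C i) powr t)))"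
      by (intro mult_left_mono le) simp
    also have "\<dots> = (\<Sum>i. ennreal (diameter (C i) powr t))"
      using K' by (simp add: mult.assoc[symmetric] flip: ennreal_mult)
    finally show "ennreal (prob E / K') \<le> (\<Sum>i. ennreal (diameter (C i) powr t))" .
  qed
  also have "\<dots> \<le> hausdorff_measure t U"
    unfolding hausdorff_measure_def using \<rho> by (intro SUP_upper) auto
  finally show "hausdorff_measure t U \<noteq> 0"
    using posE K' by (auto simp: ennreal_eq_0_iff divide_le_0_iff)
qed

section \<open>The projected iterated function system\<close>

text \<open>The square of the left side is the inner product of \<open>z\<close> with
  \<open>A *v (transpose A *v z)\<close>; Cauchy-Schwarz and the operator norm of \<open>A\<close>
  leave one factor to cancel.\<close>

lemma norm_transpose_mult_le:
  fixes A :: "real^'n^'n"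
  shows "norm (transpose A *v z) \<le> onorm (\<lambda>x. A *v x) * norm z"
proof -
  have "norm (transpose A *v z) * norm (transpose A *v z) = z \<bullet> (A *v (transpose A *v z))"
    by (simp add: dot_lmul_matrix flip: dot_square_norm power2_eq_square)
  also have "\<dots> \<le> norm z * norm (A *v (transpose A *v z))"
    by (rule norm_cauchy_schwarz)
  also have "\<dots> \<le> norm z * (onorm (\<lambda>x. A *v x) * norm (transpose A *v z))"
    by (intro mult_left_mono onorm matrix_vector_mul_bounded_linear) simp
  finally have "norm (transpose A *v z) * norm (transpose A *v z)
      \<le> (onorm (\<lambda>x. A *v x) * norm z) * norm (transpose A *v z)"
    by (simp add: mult_ac)
  note le = this
  show ?thesis
  proof (cases "norm (transpose A *v z) = 0")
    case True
    then show ?thesis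
      using onorm_pos_le[OF matrix_vector_mul_bounded_linear, of A] by (simp only: True) simp
  next
    case False
    then have "0 < norm (transpose A *v z)" by simp
    with le show ?thesis by (rule mult_right_le_imp_le)
  qed
qed

section \<open>Prefixes, cylinders and the Bernoulli measure\<close>

lemma length_prefix [simp]: "length (prefix a n) = n"
  by (simp add: prefix_def)

lemma nth_prefix [simp]: "i < n \<Longrightarrow> prefix a n ! i = a i"
  by (simp add: prefix_def)

lemma prefix_add: "prefix a (m + n) = prefix a m @ map a [m..<m + n]"
  unfolding prefix_def using upt_add_eq_append[of 0 m n] by simp

lemma prefix_eq_iff: "prefix a n = prefix b n \<longleftrightarrow> (\<forall>i<n. a i = b i)"
  by (auto simp: list_eq_iff_nth_eq)

lemma prefix_eq_le: "prefix a n = prefix b n \<Longrightarrow> m \<le> n \<Longrightarrow> prefix a m = prefix b m"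
  by (simp add: prefix_eq_iff)

lemma cyl_iff: "b \<in> cyl w \<longleftrightarrow> prefix b (length w) = w"
  by (auto simp: cyl_def list_eq_iff_nth_eq)

lemma space_bernoulli [simp]: "space (bernoulli p) = UNIV"
  by (simp add: bernoulli_def space_PiM)

lemma prob_space_bernoulli: "prob_space (bernoulli p)"
  unfolding bernoulli_def by (intro prob_space_PiM) (rule prob_space_measure_pmf)

lemma cyl_sets [measurable]: "cyl w \<in> sets (bernoulli p)"
proof -
  have "{b \<in> space (bernoulli p). \<forall>j\<in>{..<length w}. b j = w ! j} \<in> sets (bernoulli p)"
  proof (rule sets.sets_Collect_finite_All)
    fix j
    have "(\<lambda>b. b j) \<in> measurable (bernoulli p) (measure_pmf p)"
      unfolding bernoulli_def by measurable
    from measurable_sets[OF this, of "{w ! j}"]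
    show "{b \<in> space (bernoulli p). b j = w ! j} \<in> sets (bernoulli p)"
      by (simp add: vimage_def)
  qed auto
  then show ?thesis by (simp add: cyl_def Ball_def)
qed

lemma simple_function_bernoulli:
  fixes g :: "(nat \<Rightarrow> 'a::finite) \<Rightarrow> 'b"
  assumes "\<And>a b. prefix a n = prefix b n \<Longrightarrow> g a = g b"
  shows "simple_function (bernoulli p) g"
proof (rule simple_function_factor)
  have fin: "finite (range (\<lambda>a :: nat \<Rightarrow> 'a. prefix a n))"
    by (rule finite_subset[OF _ finite_lists_length_eq[of UNIV n]]) auto
  have "(\<lambda>a. prefix a n) -` {prefix b n} = cyl (prefix b n)" for b :: "nat \<Rightarrow> 'a"
    by (auto simp: cyl_iff)
  then show "simple_function (bernoulli p) (\<lambda>a. prefix a n)"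
    using fin by (auto simp: simple_function_def)
qed (rule assms)

lemma cond_cyl_eq: "cond_cyl \<mu> w = uniform_measure \<mu> (cyl w)"
  by (simp add: cond_cyl_def uniform_measure_def)

section \<open>Projected discs and the coding map\<close>

locale ifs_projection =
  fixes A :: "'a::finite \<Rightarrow> real^2^2" and d :: "'a \<Rightarrow> real^2" and p :: "'a pmf" and u :: "real^2"
  assumes contr: "\<forall>i. onorm (\<lambda>x. A i *v x) < 1"
    and inv: "\<forall>i. (\<lambda>x. A i *v x + d i) ` cball 0 1 \<subseteq> cball 0 1"
    and theta: "norm u = 1"
begin

definition T :: "'a \<Rightarrow> real^2 \<Rightarrow> real^2" where "T i x = A i *v x + d i"

text \<open>The transposed linear part of \<open>compT T w\<close> applied to the normal of the
  line. Transposition reverses the order of the factors, so appending a letter applies one more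
  matrix on the outside. The norm is the half-width of the projected disc.\<close>

definition dual :: "'a list \<Rightarrow> real^2" where
  "dual w = foldl (\<lambda>z i. transpose (A i) *v z) (perp u) w"

definition centre :: "'a list \<Rightarrow> real" where "centre w = proj u (compT T w 0)"

definition \<kappa> :: real where "\<kappa> = Max (range (\<lambda>i. onorm (\<lambda>x. A i *v x)))"

definition F :: "(nat \<Rightarrow> 'a) \<Rightarrow> real" where "F a = proj u (coding T a)"

lemma onorm_le_\<kappa>: "onorm (\<lambda>x. A i *v x) \<le> \<kappa>"
  unfolding \<kappa>_def by (rule Max_ge) auto

lemma \<kappa>_nonneg: "0 \<le> \<kappa>"
  using onorm_pos_le[OF matrix_vector_mul_bounded_linear] onorm_le_\<kappa> by (rule order_trans)

lemma \<kappa>_less_1: "\<kappa> < 1"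
  using contr unfolding \<kappa>_def by (subst Max_less_iff) auto

lemma compT_Nil [simp]: "compT T [] = id"
  and compT_Cons [simp]: "compT T (i # w) = T i \<circ> compT T w"
  by (simp_all add: compT_def)

lemma compT_append: "compT T (w @ w') = compT T w \<circ> compT T w'"
  by (induction w) (auto simp: fun_eq_iff)

lemma T_cball: "x \<in> cball 0 1 \<Longrightarrow> T i x \<in> cball 0 1"
  using inv unfolding T_def by blast

lemma compT_cball: "x \<in> cball 0 1 \<Longrightarrow> compT T w x \<in> cball 0 1"
proof (induction w)
  case (Cons i w)
  then show ?case using T_cball[of "compT T w x" i] by simp
qed simp

lemma norm_T_diff_le: "norm (T i x - T i y) \<le> \<kappa> * norm (x - y)"
proof -
  have "norm (T i x - T i y) = norm (A i *v (x - y))"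
    by (simp add: T_def matrix_vector_mult_diff_distrib)
  also have "\<dots> \<le> onorm (\<lambda>x. A i *v x) * norm (x - y)"
    by (intro onorm matrix_vector_mul_bounded_linear)
  also have "\<dots> \<le> \<kappa> * norm (x - y)" by (intro mult_right_mono onorm_le_\<kappa>) simp
  finally show ?thesis .
qed

lemma norm_compT_diff_le: "norm (compT T w x - compT T w y) \<le> \<kappa> ^ length w * norm (x - y)"
proof (induction w)
  case (Cons i w)
  have "norm (compT T (i # w) x - compT T (i # w) y) \<le> \<kappa> * norm (compT T w x - compT T w y)"
    by (simp add: norm_T_diff_le)
  also have "\<dots> \<le> \<kappa> * (\<kappa> ^ length w * norm (x - y))"
    using Cons \<kappa>_nonneg by (rule mult_left_mono)
  finally show ?case by simp
qed simp

lemma proj_compT: "proj u (compT T w x) = centre w + x \<bullet> dual w"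
proof -
  \<comment> \<open>The normal is generalised to \<open>v\<close> because removing the first map
    replaces it by its image under the transpose.\<close>
  have "compT T w x \<bullet> v = compT T w 0 \<bullet> v + x \<bullet> foldl (\<lambda>z i. transpose (A i) *v z) v w" for v
  proof (induction w arbitrary: v)
    case (Cons i w)
    have "T i y \<bullet> v = d i \<bullet> v + y \<bullet> (transpose (A i) *v v)" for y
      by (simp add: T_def inner_add_left dot_lmul_matrix)
        (metis dot_lmul_matrix inner_commute transpose_matrix_vector)
    then show ?case using Cons[of "transpose (A i) *v v"] by simp
  qed simp
  then show ?thesis by (simp add: proj_def centre_def dual_def)
qed

lemma dual_snoc: "dual (w @ [i]) = transpose (A i) *v dual w"
  by (simp add: dual_def)

lemma dual_Nil: "dual [] = perp u"
  by (simp add: dual_def)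

lemma norm_perp: "norm (perp u) = 1"
  using theta by (simp add: perp_def norm_eq_sqrt_inner inner_vec_def sum_2 add.commute)

lemma norm_dual_le: "norm (dual w) \<le> \<kappa> ^ length w"
proof (induction w rule: rev_induct)
  case Nil
  then show ?case by (simp add: dual_Nil norm_perp)
next
  case (snoc i w)
  have "norm (dual (w @ [i])) \<le> onorm (\<lambda>x. A i *v x) * norm (dual w)"
    unfolding dual_snoc by (rule norm_transpose_mult_le)
  also have "\<dots> \<le> \<kappa> * \<kappa> ^ length w"
    by (intro mult_mono onorm_le_\<kappa> snoc \<kappa>_nonneg) simp
  finally show ?case by simp
qed

lemma centre_append: "\<bar>centre (w @ w') - centre w\<bar> \<le> norm (dual w)"
proof -
  have "centre (w @ w') - centre w = compT T w' 0 \<bullet> dual w"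
    unfolding centre_def compT_append using proj_compT[of w "compT T w' 0"] proj_compT[of w 0]
    by simp
  also have "\<bar>\<dots>\<bar> \<le> norm (compT T w' 0) * norm (dual w)" by (rule Cauchy_Schwarz_ineq2)
  also have "\<dots> \<le> 1 * norm (dual w)"
    using compT_cball[of 0 w'] by (intro mult_right_mono) auto
  finally show ?thesis by simp
qed

lemma proj_Dw: "proj u ` Dw T w = {centre w - norm (dual w) .. centre w + norm (dual w)}"
proof (intro subset_antisym subsetI)
  fix t assume "t \<in> proj u ` Dw T w"
  then obtain x where x: "norm x \<le> 1" "t = centre w + x \<bullet> dual w"
    by (auto simp: Dw_def proj_compT)
  have "\<bar>x \<bullet> dual w\<bar> \<le> norm x * norm (dual w)" by (rule Cauchy_Schwarz_ineq2)
  also have "\<dots> \<le> 1 * norm (dual w)" using x by (intro mult_right_mono) auto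
  finally show "t \<in> {centre w - norm (dual w) .. centre w + norm (dual w)}" using x by auto
next
  fix t assume t: "t \<in> {centre w - norm (dual w) .. centre w + norm (dual w)}"
  \<comment> \<open>A preimage on the line of \<open>dual w\<close>. If \<open>dual w = 0\<close>,
    division by zero makes it 0 and \<open>t\<close> is the centre itself.\<close>
  define x where "x = ((t - centre w) / (norm (dual w))\<^sup>2) *\<^sub>R dual w"
  have "\<bar>t - centre w\<bar> \<le> norm (dual w)" using t by auto
  then have "norm x \<le> 1" "t = centre w + x \<bullet> dual w"
    by (cases "dual w = 0"; auto simp: x_def power2_eq_square divide_le_eq dot_square_norm field_simps)+
  then show "t \<in> proj u ` Dw T w"
    unfolding Dw_def by (intro image_eqI[OF _ imageI[of x]]) (auto simp: proj_compT)
qed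

lemma wlen_eq: "wlen T u w = - log 2 (norm (dual w))"
  by (simp add: wlen_def proj_Dw)

text \<open>\<open>coding\<close> is a definite description: nested compact discs give existence,
  and their diameters, at most \<open>\<kappa> ^ n * 2\<close>, give uniqueness.\<close>

lemma coding_in_Dw: "coding T a \<in> Dw T (prefix a n)"
proof -
  have comp: "compact (Dw T w)" for w
  proof -
    have "continuous_on UNIV (compT T w)"
    proof (induction w)
      case (Cons i w)
      have "continuous_on UNIV (T i)"
        unfolding T_def[abs_def] by (intro continuous_intros linear_continuous_on matrix_vector_mul_bounded_linear)
      then show ?case using Cons by (auto intro: continuous_on_compose2)
    qed (simp add: continuous_on_id)
    then show ?thesis unfolding Dw_def
      by (intro compact_continuous_image) (auto intro: continuous_on_subset)
  qed
  have mono: "Dw T (prefix a n) \<subseteq> Dw T (prefix a m)" if mn: "m \<le> n" for m n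
  proof -
    obtain k where "n = m + k" using le_Suc_ex[OF mn] by blast
    then show ?thesis
      unfolding Dw_def by (auto simp: prefix_add compT_append simp del: mem_cball intro: imageI compT_cball)
  qed
  have "(\<Inter>n. Dw T (prefix a n)) \<noteq> {}"
    by (rule compact_nest[OF comp _ mono]) (auto simp: Dw_def)
  then obtain x where x: "x \<in> (\<Inter>n. Dw T (prefix a n))" by blast
  have "y = x" if y: "y \<in> (\<Inter>n. Dw T (prefix a n))" for y
  proof -
    have le: "norm (y - x) \<le> \<kappa> ^ n * 2" for n
    proof -
      obtain x' y' where "x = compT T (prefix a n) x'" "y = compT T (prefix a n) y'"
        "norm x' \<le> 1" "norm y' \<le> 1"
        using x y by (fastforce simp: Dw_def)
      moreover from this have "norm (y' - x') \<le> 2"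
        using norm_triangle_ineq4[of y' x'] by simp
      ultimately show ?thesis
        using norm_compT_diff_le[of "prefix a n" y' x'] \<kappa>_nonneg
        by (simp add: order_trans[OF _ mult_left_mono])
    qed
    have lim: "(\<lambda>n. \<kappa> ^ n * 2) \<longlonglongrightarrow> 0 * 2"
      using \<kappa>_nonneg \<kappa>_less_1 by (intro tendsto_intros LIMSEQ_power_zero) auto
    have "norm (y - x) \<le> 0 * 2"
      by (rule LIMSEQ_le_const[OF lim]) (use le in blast)
    then show ?thesis by simp
  qed
  then have "coding T a = x" unfolding coding_def using x by (intro the_equality)
  then show ?thesis using x by blast
qed

lemma F_near: "\<bar>F a - centre (prefix a n)\<bar> \<le> norm (dual (prefix a n))"
proof -
  have "F a \<in> proj u ` Dw T (prefix a n)"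
    unfolding F_def by (intro imageI coding_in_Dw)
  then show ?thesis unfolding proj_Dw by auto
qed

lemma tendsto_\<kappa>: "(\<lambda>n. \<kappa> ^ n) \<longlonglongrightarrow> 0"
  using \<kappa>_nonneg \<kappa>_less_1 by (intro LIMSEQ_power_zero) auto

lemma F_measurable [measurable]: "F \<in> borel_measurable (bernoulli p)"
proof (rule borel_measurable_LIMSEQ_metric)
  show "(\<lambda>a. centre (prefix a n)) \<in> borel_measurable (bernoulli p)" for n
    by (rule borel_measurable_simple_function, rule simple_function_bernoulli[of n]) simp
  show "(\<lambda>n. centre (prefix a n)) \<longlonglongrightarrow> F a" for a
  proof (rule metric_tendsto_imp_tendsto[OF tendsto_\<kappa>])
    show "\<forall>\<^sub>F n in sequentially. dist (centre (prefix a n)) (F a) \<le> dist (\<kappa> ^ n) 0"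
      using order_trans[OF F_near norm_dual_le] \<kappa>_nonneg
      by (intro always_eventually) (auto simp: dist_real_def abs_minus_commute)
  qed
qed

text \<open>The intended index \<open>nj\<close>, stated without the logarithm: a collapsed disc
  counts as small, so the least index always exists.\<close>

definition stop :: "nat \<Rightarrow> nat \<Rightarrow> (nat \<Rightarrow> 'a) \<Rightarrow> nat" where
  "stop N j a = (LEAST n. norm (dual (prefix a n)) \<le> (1 / 2 ^ N) ^ j)"

definition W :: "nat \<Rightarrow> nat \<Rightarrow> (nat \<Rightarrow> 'a) \<Rightarrow> 'a list" where
  "W N j a = prefix a (stop N j a)"

lemma ex_stop_bound: "\<exists>L. \<kappa> ^ L \<le> (1 / 2 ^ N) ^ j"
proof -
  have "\<forall>\<^sub>F n in sequentially. \<kappa> ^ n < (1 / 2 ^ N) ^ j"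
    using order_tendstoD(2)[OF tendsto_\<kappa>, of "(1 / 2 ^ N) ^ j"] by simp
  then show ?thesis by (auto simp: eventually_sequentially intro: less_imp_le)
qed

lemma stop_le: "\<kappa> ^ L \<le> (1 / 2 ^ N) ^ j \<Longrightarrow> stop N j a \<le> L"
  unfolding stop_def using norm_dual_le[of "prefix a L"] by (intro Least_le) simp

lemma norm_dual_W: "norm (dual (W N j a)) \<le> (1 / 2 ^ N) ^ j"
proof -
  obtain L where "\<kappa> ^ L \<le> (1 / 2 ^ N) ^ j" using ex_stop_bound by blast
  then have "norm (dual (prefix a L)) \<le> (1 / 2 ^ N) ^ j"
    using norm_dual_le[of "prefix a L"] by simp
  then show ?thesis unfolding W_def stop_def by (rule LeastI)
qed

text \<open>\<open>stop\<close> is a stopping time: the letters read so far decide it. Hence the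
  atoms of \<open>W N j\<close> are cylinders, and conditioning on them is
  \<open>cond_cyl\<close>.\<close>

lemma stop_cong:
  assumes "prefix b (stop N j a) = prefix a (stop N j a)"
  shows "stop N j b = stop N j a"
  unfolding stop_def[of N j b]
proof (rule Least_equality)
  show "norm (dual (prefix b (stop N j a))) \<le> (1 / 2 ^ N) ^ j"
    using norm_dual_W assms by (simp add: W_def)
  fix n assume n: "norm (dual (prefix b n)) \<le> (1 / 2 ^ N) ^ j"
  show "stop N j a \<le> n"
  proof (rule ccontr)
    assume "\<not> ?thesis"
    then have "prefix b n = prefix a n" using prefix_eq_le[OF assms] by simp
    then have "stop N j a \<le> n" unfolding stop_def using n by (intro Least_le) simp
    with \<open>\<not> ?thesis\<close> show False ..
  qed
qed

lemma W_eq_iff: "W N j b = W N j a \<longleftrightarrow> b \<in> cyl (W N j a)"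
proof
  assume "W N j b = W N j a"
  moreover from arg_cong[OF this, of length] have "stop N j b = stop N j a" by (simp add: W_def)
  ultimately show "b \<in> cyl (W N j a)" by (simp add: cyl_iff W_def)
next
  assume "b \<in> cyl (W N j a)"
  then have "prefix b (stop N j a) = prefix a (stop N j a)" by (simp add: cyl_iff W_def)
  with stop_cong[OF this] show "W N j b = W N j a" by (simp add: W_def)
qed

lemma stop_mono: "stop N j a \<le> stop N (Suc j) a"
proof -
  have "(1 / 2 ^ N) ^ Suc j \<le> ((1 / 2 ^ N) ^ j :: real)"
    by (intro power_decreasing) (auto simp: divide_le_eq)
  then have "norm (dual (prefix a (stop N (Suc j) a))) \<le> (1 / 2 ^ N) ^ j"
    using norm_dual_W[of N "Suc j" a] by (simp add: W_def)
  then show ?thesis unfolding stop_def[of N j] by (rule Least_le)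
qed

lemma refining_partitions_W:
  "refining_partitions (bernoulli p) (W N) (\<lambda>j a. centre (W N j a)) F (2 ^ N)"
proof -
  interpret prob_space "bernoulli p" by (rule prob_space_bernoulli)
  show ?thesis
  proof
    fix j
    \<comment> \<open>Uniform contraction bounds \<open>stop\<close> by \<open>L\<close> for all
      sequences, so \<open>W N j\<close> depends on \<open>L\<close> letters only and takes finitely
      many values.\<close>
    obtain L where L: "\<kappa> ^ L \<le> (1 / 2 ^ N) ^ j" using ex_stop_bound by blast
    show "simple_function (bernoulli p) (W N j)"
    proof (rule simple_function_bernoulli)
      fix a b :: "nat \<Rightarrow> 'a" assume "prefix a L = prefix b L"
      from prefix_eq_le[OF this stop_le[OF L]] show "W N j a = W N j b"
        by (simp add: W_eq_iff) (simp add: cyl_iff W_def)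
    qed
  next
    fix j and a b :: "nat \<Rightarrow> 'a" assume "W N (Suc j) a = W N (Suc j) b"
    then have "prefix a (stop N (Suc j) b) = prefix b (stop N (Suc j) b)"
      by (simp add: W_eq_iff) (simp add: cyl_iff W_def)
    from prefix_eq_le[OF this stop_mono] show "W N j a = W N j b"
      by (simp add: W_eq_iff) (simp add: cyl_iff W_def)
  next
    fix j a
    show "\<bar>F a - centre (W N j a)\<bar> \<le> (1 / real (2 ^ N)) ^ j"
      using order_trans[OF F_near norm_dual_W[unfolded W_def]] by (simp add: W_def)
    obtain k where "stop N (Suc j) a = stop N j a + k" using le_Suc_ex[OF stop_mono] by blast
    then have "W N (Suc j) a = W N j a @ map a [stop N j a..<stop N j a + k]"
      by (simp add: W_def prefix_add)
    then show "\<bar>centre (W N (Suc j) a) - centre (W N j a)\<bar> \<le> (1 / real (2 ^ N)) ^ j"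
      using order_trans[OF centre_append norm_dual_W] by simp
  qed (auto simp: F_measurable)
qed

text \<open>Non-vanishing matters because \<open>log 2 0 = 0\<close>: a collapsed word would have
  length 0 for \<open>wlen\<close> instead of infinity.\<close>

lemma nj_eq_stop:
  assumes "\<And>n. dual (prefix a n) \<noteq> 0"
  shows "nj T u a N j = stop N j a"
proof -
  have "real (N * j) \<le> wlen T u (prefix a n) \<longleftrightarrow> norm (dual (prefix a n)) \<le> (1 / 2 ^ N) ^ j" for n
  proof -
    have "real (N * j) \<le> wlen T u (prefix a n) \<longleftrightarrow> log 2 (norm (dual (prefix a n))) \<le> - real (N * j)"
      by (auto simp: wlen_eq)
    also have "\<dots> \<longleftrightarrow> norm (dual (prefix a n)) \<le> 2 powr (- real (N * j))"
      using assms by (subst log_le_iff) auto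
    also have "2 powr (- real (N * j)) = (1 / 2 ^ N) ^ j"
      by (simp add: powr_minus powr_realpow power_mult power_divide inverse_eq_divide flip: of_nat_mult)
    finally show ?thesis .
  qed
  then show ?thesis unfolding nj_def stop_def by simp
qed

end

lemma scale_2_powr: "2 powr (- ((real i + 1) * real N)) = (1 / real (2 ^ N)) ^ Suc i"
proof -
  have "2 powr (- ((real i + 1) * real N)) = 2 powr (- real (N * Suc i))"
    by (simp add: algebra_simps)
  also have "\<dots> = 1 / 2 ^ (N * Suc i)"
    unfolding powr_minus by (subst powr_realpow) (simp_all add: inverse_eq_divide)
  also have "\<dots> = (1 / real (2 ^ N)) ^ Suc i"
    by (simp only: power_mult power_one_over of_nat_power of_nat_numeral)
  finally show ?thesis .
qed

context ifs_projection
begin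

section \<open>The dimension bound when collapse is not almost sure\<close>

definition word_entropy :: "nat \<Rightarrow> nat \<Rightarrow> 'a list \<Rightarrow> real" where
  "word_entropy N i w =
    scale_entropy (2 powr (- ((real i + 1) * real N))) (proj_meas T u (cond_cyl (bernoulli p) w))"

lemma proj_meas_eq: "proj_meas T u \<nu> = distr \<nu> borel F"
  by (simp add: proj_meas_def F_def[abs_def])

text \<open>Collapse may still have positive probability. The argument uses the non-null set of
  sequences that never collapse, on which \<open>nj\<close> is the stopping index.\<close>

lemma dim_ge_if_nondegenerate:
  assumes nondeg: "\<not> (AE a in bernoulli p. \<exists>n. dual (prefix a n) = 0)"
    and hyp: "AE a in bernoulli p. \<exists>L.
       ((\<lambda>N. liminf (\<lambda>n. ereal (1 / (real N * ln 2) * (1 / real n) *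
          (\<Sum>i=1..n. word_entropy N i (prefix a (nj T u a N i)))))) \<longlongrightarrow> L) sequentially \<and> L \<ge> ereal C"
  shows "C \<le> hausdorff_dim_measure (proj_meas T u (bernoulli p))"
proof (rule dense_le)
  fix s assume "s < C"
  then obtain C' where C': "s < C'" "C' < C" using dense by blast
  define g where "g = (C' - s) * ln 2"
  have g: "0 < g" using C' by (simp add: g_def)
  \<comment> \<open>From \<open>N1\<close> on, the gap between \<open>C'\<close> and
    \<open>s\<close> pays for the loss \<open>ln 12 + 1\<close> per stage.\<close>
  obtain N1 :: nat where N1: "ln 12 + 1 \<le> real N1 * g" "1 \<le> N1"
  proof -
    obtain m :: nat where "(ln 12 + 1) / g < real m" using reals_Archimedean2 by blast
    then have "ln 12 + 1 \<le> real (Suc m) * g" using g by (simp add: field_simps)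
    then show ?thesis by (rule that) simp
  qed
  define h where "h N = real N * ln 2 * C'" for N
  \<comment> \<open>The \<open>N\<close> obtained from the limit depends on the sequence. If every
    \<open>N\<close> failed almost surely, all of them would fail at once off a null set,
    contradicting the hypothesis on the sequences that never collapse.\<close>
  have "\<exists>N\<ge>N1. \<not> (AE a in bernoulli p. \<not> (\<forall>\<^sub>F n in sequentially.
      real n * h N \<le> (\<Sum>i=1..n. word_entropy N i (W N i a))))"
  proof (rule ccontr)
    assume "\<not> ?thesis"
    then have "AE a in bernoulli p. \<forall>N. N1 \<le> N \<longrightarrow> \<not> (\<forall>\<^sub>F n in sequentially.
      real n * h N \<le> (\<Sum>i=1..n. word_entropy N i (W N i a)))"
      by (subst AE_all_countable) (auto intro: AE_I2)
    then have "AE a in bernoulli p. \<exists>n. dual (prefix a n) = 0"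
      using hyp
    proof eventually_elim
      case (elim a)
      show ?case
      proof (rule ccontr)
        assume no: "\<not> ?case"
        then have nj: "nj T u a N i = stop N i a" for N i by (intro nj_eq_stop) auto
        obtain L where L: "((\<lambda>N. liminf (\<lambda>n. ereal (1 / (real N * ln 2) * (1 / real n) *
          (\<Sum>i=1..n. word_entropy N i (prefix a (nj T u a N i)))))) \<longlongrightarrow> L) sequentially"
          and "ereal C \<le> L" using elim(2) by blast
        then have "ereal C' < L" using C' less_le_trans[of "ereal C'" "ereal C" L] by simp
        from order_tendstoD(1)[OF L this] have "\<forall>\<^sub>F N in sequentially. N1 \<le> N \<and>
          ereal C' < liminf (\<lambda>n. ereal (1 / (real N * ln 2) * (1 / real n) *
            (\<Sum>i=1..n. word_entropy N i (prefix a (nj T u a N i)))))"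
          using eventually_ge_at_top[of N1] by eventually_elim auto
        then obtain N where N: "N1 \<le> N" and lim: "ereal C' < liminf (\<lambda>n. ereal (1 / (real N * ln 2) * (1 / real n) *
            (\<Sum>i=1..n. word_entropy N i (prefix a (nj T u a N i)))))"
          by (auto simp: eventually_sequentially)
        have "\<forall>\<^sub>F n in sequentially. real n * h N \<le> (\<Sum>i=1..n. word_entropy N i (W N i a))"
          using less_LiminfD[OF lim] eventually_gt_at_top[of 0]
        proof eventually_elim
          case (elim n)
          have D: "0 < real N * ln 2 * real n" using N N1 elim by simp
          have "C' < (\<Sum>i=1..n. word_entropy N i (W N i a)) / (real N * ln 2 * real n)"
            using elim unfolding nj W_def[symmetric] by simp
          then have "C' * (real N * ln 2 * real n) < (\<Sum>i=1..n. word_entropy N i (W N i a))"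
            using pos_less_divide_eq[OF D] by blast
          then show ?case by (simp add: h_def mult_ac)
        qed
        with elim(1) N show False by blast
      qed
    qed
    with nondeg show False by blast
  qed
  then obtain N where N: "N1 \<le> N" and not_AE: "\<not> (AE a in bernoulli p. \<not> (\<forall>\<^sub>F n in sequentially.
      real n * h N \<le> (\<Sum>i=1..n. word_entropy N i (W N i a))))" by blast
  interpret refining_partitions "bernoulli p" "W N" "\<lambda>j a. centre (W N j a)" F "2 ^ N"
    by (rule refining_partitions_W)
  have atom: "atom j a = cyl (W N j a)" for j a
    by (auto simp: atom_def W_eq_iff)
  have H: "H i a = word_entropy N i (W N i a)" for i a
    unfolding H_def word_entropy_def proj_meas_eq cond_def cond_cyl_eq atom scale_2_powr ..
  from exists_regular_subset[of "h N", unfolded H, OF not_AE]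
  obtain E n0 where E: "E \<in> sets (bernoulli p)" "0 < prob E"
    and ball: "\<And>n z. n \<ge> n0 \<Longrightarrow> prob {x\<in>E. F x \<in> ball z ((1 / real (2 ^ N)) ^ Suc n)}
      \<le> 5 * exp (- real n * (h N - ln 12 - 1))" by blast
  show "s \<le> hausdorff_dim_measure (proj_meas T u (bernoulli p))"
    unfolding proj_meas_eq
  proof (rule mass_distribution[OF F_measurable E])
    show "2 \<le> (2 ^ N :: nat)" using N N1 self_le_power[of 2 N] by simp
    fix n z assume n: "n0 \<le> n"
    have "real N1 * g \<le> real N * g" using N g by (intro mult_right_mono) auto
    then have "real N * ln 2 * s \<le> h N - ln 12 - 1"
      using N1 by (simp add: h_def g_def algebra_simps)
    then have "real n * (real N * ln 2 * s) \<le> real n * (h N - ln 12 - 1)"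
      by (intro mult_left_mono) auto
    then have "exp (- real n * (h N - ln 12 - 1)) \<le> exp (- (real n * (real N * ln 2 * s)))"
      by simp
    also have "\<dots> = ((1 / real (2 ^ N)) ^ n) powr s"
      by (simp add: powr_def ln_realpow ln_div algebra_simps)
    finally show "prob {x\<in>E. F x \<in> ball z ((1 / real (2 ^ N)) ^ Suc n)} \<le> 5 * ((1 / real (2 ^ N)) ^ n) powr s"
      using order_trans[OF ball[OF n]] by simp
  qed simp
qed

end

section \<open>Degenerate projections\<close>

text \<open>With \<open>\<lambda> > \<lambda>'\<close> the eigenvalues and \<open>s = \<lambda> - a\<close>, the vectors \<open>(c, s)\<close> and \<open>(s, -b)\<close> are left
  eigenvectors, so the two linear forms below grow like \<open>\<lambda>\<^sup>n\<close> and \<open>\<lambda>'\<^sup>n\<close>.\<close>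

lemma positive_matrix_orbit_enters_cone:
  fixes a b c d :: real and x y :: "nat \<Rightarrow> real"
  assumes pos: "0 < a" "0 < b" "0 < c" "0 < d"
    and x: "\<And>n. x (Suc n) = a * x n + b * y n"
    and y: "\<And>n. y (Suc n) = c * x n + d * y n"
    and indep: "x 0 * y 1 \<noteq> y 0 * x 1"
  shows "\<exists>n. (0 < x n \<and> 0 < y n) \<or> (x n < 0 \<and> y n < 0)"
proof -
  define D where "D = sqrt ((a - d)\<^sup>2 + 4 * b * c)"
  define l where "l = (a + d + D) / 2"
  define l' where "l' = (a + d - D) / 2"
  define s where "s = l - a"
  have D2: "D\<^sup>2 = (a - d)\<^sup>2 + 4 * b * c" unfolding D_def using pos by simp
  have "\<bar>a - d\<bar> < D"
  proof -
    have "sqrt ((a - d)\<^sup>2) < D" unfolding D_def using pos by (intro real_sqrt_less_mono) simp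
    then show ?thesis by simp
  qed
  then have s: "0 < s" and D: "0 < D" by (auto simp: s_def l_def)
  have l: "0 < l" "\<bar>l'\<bar> < l" using D pos by (auto simp: l_def l'_def abs_less_iff)
  have l': "l' = d - s" by (simp add: l'_def s_def l_def field_simps)
  have ls: "l = a + s" by (simp add: s_def)
  \<comment> \<open>The characteristic equation at the root \<open>l = a + s\<close>.\<close>
  have char: "s * (a + s) = b * c + d * s"
  proof -
    have D': "D = 2 * s + a - d" by (simp add: s_def l_def field_simps)
    have "4 * (s * (a + s) - d * s) = D\<^sup>2 - (a - d)\<^sup>2"
      unfolding D' by (simp add: power2_eq_square algebra_simps)
    then show ?thesis using D2 by simp
  qed
  define P where "P n = c * x n + s * y n" for n
  define Q where "Q n = s * x n - b * y n" for n
  have P: "P n = l ^ n * P 0" for n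
  proof (induction n)
    case (Suc n)
    have "P (Suc n) = c * (a + s) * x n + (b * c + d * s) * y n"
      by (simp add: P_def x y algebra_simps)
    also have "\<dots> = l * P n" unfolding char[symmetric] ls P_def by (simp add: algebra_simps)
    finally show ?case using Suc by simp
  qed simp
  have Q: "Q n = l' ^ n * Q 0" for n
  proof (induction n)
    case (Suc n)
    have "Q (Suc n) = (s * a - b * c) * x n + b * (s - d) * y n"
      by (simp add: Q_def x y algebra_simps)
    also have "s * a - b * c = s * (d - s)" using char by (simp add: algebra_simps)
    also have "s * (d - s) * x n + b * (s - d) * y n = l' * Q n"
      unfolding l' Q_def by (simp add: algebra_simps)
    finally show ?case using Suc by simp
  qed simp
  \<comment> \<open>The kernel of this form is the eigenline of \<open>l'\<close>; a start on it
    would make the first two vectors of the orbit parallel, against \<open>indep\<close>.\<close>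
  have P0: "P 0 \<noteq> 0"
  proof
    assume "P 0 = 0"
    then have y0: "s * y 0 = - c * x 0" by (simp add: P_def)
    have "s * (x 0 * y 1 - y 0 * x 1)
        = s * x 0 * (c * x 0) + x 0 * d * (s * y 0) - (s * y 0) * (a * x 0) - b * y 0 * (s * y 0)"
      by (simp add: x y algebra_simps)
    also have "\<dots> = x 0 * (c * (s - d + a) * x 0 + b * c * y 0)"
      unfolding y0 by (simp add: algebra_simps)
    finally have "s * (s * (x 0 * y 1 - y 0 * x 1))
        = s * (x 0 * (c * (s - d + a) * x 0 + b * c * y 0))" by (simp only:)
    also have "\<dots> = x 0 * (c * (s * (a + s) - d * s) * x 0 + b * c * (s * y 0))"
      by (simp add: algebra_simps)
    also have "\<dots> = 0" unfolding y0 char by (simp add: algebra_simps)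
    finally show False using indep s by simp
  qed
  have xy: "(b * c + s\<^sup>2) * x n = b * P n + s * Q n" "(b * c + s\<^sup>2) * y n = s * P n - c * Q n" for n
    by (simp_all add: P_def Q_def power2_eq_square algebra_simps)
  have den: "0 < b * c + s\<^sup>2" using pos by (simp add: add_pos_nonneg)
  \<comment> \<open>Once the ratio of \<open>Q n\<close> to \<open>P n\<close> is below
    \<open>e\<close> in absolute value, \<open>P n\<close> dominates both expressions in
    \<open>xy\<close>, so both coordinates have its sign.\<close>
  define e where "e = min (b / s) (s / c)"
  have e: "0 < e" "e * s \<le> b" "e * c \<le> s"
    using pos s by (auto simp: e_def min_def field_simps)
  have "(\<lambda>n. (l' / l) ^ n * (Q 0 / P 0)) \<longlonglongrightarrow> 0 * (Q 0 / P 0)"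
    using l by (intro tendsto_intros LIMSEQ_power_zero) (auto simp: abs_divide)
  then have "\<forall>\<^sub>F n in sequentially. \<bar>(l' / l) ^ n * (Q 0 / P 0)\<bar> < e"
    using e(1) by (auto dest!: tendstoD simp: dist_real_def)
  then obtain n where "\<bar>(l' / l) ^ n * (Q 0 / P 0)\<bar> < e"
    by (auto simp: eventually_sequentially)
  moreover have "(l' / l) ^ n * (Q 0 / P 0) = Q n / P n"
    unfolding P[of n] Q[of n] by (simp add: power_divide)
  ultimately have "\<bar>Q n\<bar> / \<bar>P n\<bar> < e" by (simp only: abs_divide)
  moreover have Pn: "P n \<noteq> 0" unfolding P[of n] using P0 l by simp
  ultimately have Qn: "\<bar>Q n\<bar> < e * \<bar>P n\<bar>" by (simp add: pos_divide_less_eq)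
  have "\<bar>s * Q n\<bar> < b * \<bar>P n\<bar>" "\<bar>c * Q n\<bar> < s * \<bar>P n\<bar>"
  proof -
    have "\<bar>s * Q n\<bar> < s * (e * \<bar>P n\<bar>)" "\<bar>c * Q n\<bar> < c * (e * \<bar>P n\<bar>)"
      using Qn s pos by (simp_all add: abs_mult)
    moreover have "s * (e * \<bar>P n\<bar>) \<le> b * \<bar>P n\<bar>" "c * (e * \<bar>P n\<bar>) \<le> s * \<bar>P n\<bar>"
      using mult_right_mono[OF e(2), of "\<bar>P n\<bar>"] mult_right_mono[OF e(3), of "\<bar>P n\<bar>"]
      by (simp_all add: mult_ac)
    ultimately show "\<bar>s * Q n\<bar> < b * \<bar>P n\<bar>" "\<bar>c * Q n\<bar> < s * \<bar>P n\<bar>" by linarith+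
  qed
  then have "(0 < b * P n + s * Q n \<and> 0 < s * P n - c * Q n) \<or>
      (b * P n + s * Q n < 0 \<and> s * P n - c * Q n < 0)"
    by (cases "0 < P n") (auto simp: abs_less_iff not_less)
  then show ?thesis unfolding xy[symmetric] using den
    by (intro exI[of _ n]) (simp add: zero_less_mult_iff mult_less_0_iff)
qed

lemma emeasure_bernoulli_restrict:
  "emeasure (bernoulli p) {b. \<forall>j<n. b j \<in> X j} = (\<Prod>j<n. emeasure (measure_pmf p) (X j))"
proof -
  interpret product_prob_space "\<lambda>_ :: nat. measure_pmf p" UNIV
    by (intro product_prob_spaceI prob_space_measure_pmf)
  have "emeasure (bernoulli p) {b \<in> space (bernoulli p). \<forall>j\<in>{..<n}. b j \<in> X j}
      = (\<Prod>j<n. emeasure (measure_pmf p) (X j))"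
    unfolding bernoulli_def by (rule emeasure_PiM_Collect) auto
  then show ?thesis by (simp add: Ball_def)
qed

lemma emeasure_cyl: "emeasure (bernoulli p) (cyl w) = ennreal (\<Prod>j<length w. pmf p (w ! j))"
proof -
  have "cyl w = {b. \<forall>j<length w. b j \<in> {w ! j}}" by (auto simp: cyl_def)
  then have "emeasure (bernoulli p) (cyl w) = (\<Prod>j<length w. ennreal (pmf p (w ! j)))"
    by (simp only: emeasure_bernoulli_restrict emeasure_pmf_single)
  then show ?thesis by (simp add: prod_ennreal)
qed

lemma AE_bernoulli_set_pmf: "AE a in bernoulli p. \<forall>j. a j \<in> set_pmf p"
proof (subst AE_all_countable, rule allI)
  fix j
  have "AE x in measure_pmf p. x \<in> set_pmf p" by (rule AE_pmfI)
  then show "AE a in bernoulli p. a j \<in> set_pmf p"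
    unfolding bernoulli_def
    by (intro AE_PiM_component) (auto intro: prob_space_measure_pmf)
qed

context ifs_projection
begin

section \<open>The common eigenvector and the collapse time\<close>

definition kernel :: "'a set" where
  "kernel = {i. transpose (A i) *v perp u = 0}"

definition hit :: "(nat \<Rightarrow> 'a) \<Rightarrow> nat" where
  "hit b = (LEAST j. b j \<in> kernel)"

lemma dual_append: "dual w = 0 \<Longrightarrow> dual (w @ w') = 0"
  by (induction w' rule: rev_induct) (simp_all add: dual_snoc flip: append_assoc)

lemma dual_prefix_le: "dual (prefix a m) = 0 \<Longrightarrow> m \<le> n \<Longrightarrow> dual (prefix a n) = 0"
  using dual_append[of "prefix a m" "map a [m..<n]"] by (auto dest!: le_Suc_ex simp: prefix_add)

text \<open>Otherwise iterating the positive matrix \<open>transpose (A i)\<close> drives the normal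
  into the open positive or negative quadrant. All the transposes preserve this double cone, which
  omits 0, so no sequence starting with enough letters \<open>i\<close> ever collapses; yet that
  cylinder has positive mass.\<close>

lemma eigenvector_if_degenerate:
  assumes pos: "\<forall>i r s. A i $ r $ s > 0"
    and deg: "AE a in bernoulli p. \<exists>n. dual (prefix a n) = 0"
    and i: "i \<in> set_pmf p"
  shows "\<exists>l. transpose (A i) *v perp u = l *\<^sub>R perp u"
proof (rule ccontr)
  assume no: "\<not> ?thesis"
  define z where "z n = dual (replicate n i)" for n
  have z_Suc: "z (Suc n) = transpose (A i) *v z n" for n
    unfolding z_def by (simp add: replicate_append_same[symmetric] dual_snoc)
  have comp: "(transpose (A j) *v w) $ r = A j $ 1 $ r * w $ 1 + A j $ 2 $ r * w $ 2" for j w r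
    by (simp add: matrix_vector_mult_def transpose_def sum_2)
  define cone where "cone w \<longleftrightarrow> (0 < w $ 1 \<and> 0 < w $ 2) \<or> (w $ 1 < 0 \<and> w $ 2 < 0)" for w :: "real^2"
  have "\<exists>n. (0 < z n $ 1 \<and> 0 < z n $ 2) \<or> (z n $ 1 < 0 \<and> z n $ 2 < 0)"
  proof (rule positive_matrix_orbit_enters_cone)
    show "z (Suc n) $ 1 = A i $ 1 $ 1 * z n $ 1 + A i $ 2 $ 1 * z n $ 2"
      "z (Suc n) $ 2 = A i $ 1 $ 2 * z n $ 1 + A i $ 2 $ 2 * z n $ 2" for n
      by (simp_all only: z_Suc comp)
    show "z 0 $ 1 * z 1 $ 2 \<noteq> z 0 $ 2 * z 1 $ 1"
    proof
      assume eq: "z 0 $ 1 * z 1 $ 2 = z 0 $ 2 * z 1 $ 1"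
      have z0: "z 0 = perp u" and z1: "z 1 = transpose (A i) *v perp u"
        using z_Suc[of 0] by (simp_all add: z_def dual_Nil)
      have "z 0 \<noteq> 0" using norm_perp z0 by auto
      then consider "z 0 $ 1 \<noteq> 0" | "z 0 $ 2 \<noteq> 0" by (auto simp: vec_eq_iff forall_2)
      then have "\<exists>l. z 1 = l *\<^sub>R z 0"
      proof cases
        case 1
        then show ?thesis using eq
          by (intro exI[of _ "z 1 $ 1 / z 0 $ 1"]) (auto simp: vec_eq_iff forall_2 field_simps)
      next
        case 2
        then show ?thesis using eq
          by (intro exI[of _ "z 1 $ 2 / z 0 $ 2"]) (auto simp: vec_eq_iff forall_2 field_simps)
      qed
      then show False using no z0 z1 by metis
    qed
  qed (use pos in auto)
  then obtain n where n: "cone (dual (replicate n i))" unfolding cone_def z_def by blast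
  have cone_step: "cone (transpose (A j) *v w)" if "cone w" for j w
    using that pos unfolding cone_def comp
    by (auto intro!: add_pos_pos add_neg_neg mult_pos_pos mult_pos_neg)
  have cone_append: "cone (dual (w @ w'))" if "cone (dual w)" for w w'
    by (induction w' rule: rev_induct) (use that cone_step in \<open>simp_all add: dual_snoc flip: append_assoc\<close>)
  have "AE a in bernoulli p. a \<notin> cyl (replicate n i)"
    using deg
  proof eventually_elim
    case (elim a)
    then obtain m where m: "dual (prefix a m) = 0" by blast
    show ?case
    proof
      assume "a \<in> cyl (replicate n i)"
      then have "prefix a n = replicate n i" by (simp add: cyl_iff)
      then have "cone (dual (prefix a (n + m)))"
        unfolding prefix_add using cone_append n by simp
      moreover have "dual (prefix a (n + m)) = 0"
        by (rule dual_prefix_le[OF m]) simp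
      ultimately show False by (simp add: cone_def)
    qed
  qed
  then have "emeasure (bernoulli p) (cyl (replicate n i)) = 0"
    by (subst (asm) AE_iff_measurable[OF cyl_sets]) auto
  then show False using i by (simp add: emeasure_cyl set_pmf_iff)
qed

lemma dual_degenerate:
  assumes eig: "\<And>i. i \<in> set_pmf p \<Longrightarrow> \<exists>l. transpose (A i) *v perp u = l *\<^sub>R perp u"
    and "set w \<subseteq> set_pmf p"
  shows "\<exists>l. dual w = l *\<^sub>R perp u \<and> (l = 0 \<longleftrightarrow> set w \<inter> kernel \<noteq> {})"
  using assms(2)
proof (induction w rule: rev_induct)
  case Nil
  then show ?case by (intro exI[of _ 1]) (simp add: dual_Nil)
next
  case (snoc i w)
  then obtain l where l: "dual w = l *\<^sub>R perp u" "l = 0 \<longleftrightarrow> set w \<inter> kernel \<noteq> {}" by auto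
  have "i \<in> set_pmf p" using snoc.prems by simp
  from eig[OF this] obtain k where k: "transpose (A i) *v perp u = k *\<^sub>R perp u" by blast
  have "perp u \<noteq> 0" using norm_perp by auto
  then have "k = 0 \<longleftrightarrow> i \<in> kernel"
    by (simp only: kernel_def mem_Collect_eq k scaleR_eq_0_iff) simp
  moreover have "dual (w @ [i]) = (l * k) *\<^sub>R perp u"
    by (simp only: dual_snoc l k matrix_vector_mult_scaleR scaleR_scaleR)
  ultimately show ?case using l by (intro exI[of _ "l * k"]) auto
qed

lemma hit_measurable [measurable]: "hit \<in> measurable (bernoulli p) (count_space UNIV)"
proof -
  have "Measurable.pred (bernoulli p) (\<lambda>b. b j \<in> kernel)" for j
    unfolding bernoulli_def by measurable
  then show ?thesis unfolding hit_def[abs_def] by measurable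
qed

text \<open>The waiting time for a letter of positive probability: its mean is the sum of its tails,
  and these are dominated by a geometric series.\<close>

lemma nn_integral_hit_finite:
  assumes "set_pmf p \<inter> kernel \<noteq> {}"
  shows "(\<integral>\<^sup>+b. of_nat (hit b) \<partial>bernoulli p) < \<infinity>"
proof -
  interpret prob_space "bernoulli p" by (rule prob_space_bernoulli)
  define q where "q = measure (measure_pmf p) (- kernel)"
  have "0 < measure (measure_pmf p) kernel"
    using assms by (auto simp: measure_pmf_posI)
  then have q: "0 \<le> q" "q < 1"
    unfolding q_def by (simp_all add: measure_pmf.prob_compl[of kernel, simplified] Compl_eq_Diff_UNIV)
  have "(\<integral>\<^sup>+b. of_nat (hit b) \<partial>bernoulli p) = (\<Sum>t. emeasure (bernoulli p) {b\<in>space (bernoulli p). t < hit b})"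
    by (rule nn_integral_nat_function) measurable
  also have "\<dots> \<le> (\<Sum>t. ennreal (q ^ t))"
  proof (intro suminf_le)
    fix t
    have "{b. \<forall>j<t. b j \<in> - kernel} \<in> sets (bernoulli p)"
    proof -
      have "{b \<in> space (bernoulli p). \<forall>j\<in>{..<t}. b j \<in> - kernel} \<in> sets (bernoulli p)"
        unfolding bernoulli_def by measurable
      then show ?thesis by (simp add: Ball_def)
    qed
    moreover have "{b\<in>space (bernoulli p). t < hit b} \<subseteq> {b. \<forall>j<t. b j \<in> - kernel}"
    proof (intro subsetI CollectI allI impI)
      fix b j assume "b \<in> {b\<in>space (bernoulli p). t < hit b}" "j < t"
      then show "b j \<in> - kernel"
        using not_less_Least[of j "\<lambda>j. b j \<in> kernel"] by (auto simp: hit_def)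
    qed
    ultimately have "emeasure (bernoulli p) {b\<in>space (bernoulli p). t < hit b}
        \<le> emeasure (bernoulli p) {b. \<forall>j<t. b j \<in> - kernel}"
      by (rule emeasure_mono[rotated])
    also have "\<dots> = ennreal (q ^ t)"
      unfolding emeasure_bernoulli_restrict q_def
      by (simp add: measure_pmf.emeasure_eq_measure ennreal_power)
    finally show "emeasure (bernoulli p) {b\<in>space (bernoulli p). t < hit b} \<le> ennreal (q ^ t)" .
  qed auto
  also have "\<dots> < \<infinity>"
    using q by (subst suminf_ennreal2) (auto intro: summable_geometric)
  finally show ?thesis .
qed

text \<open>After a letter of \<open>kernel\<close> the coded projection is constant on the cylinder
  read so far, so the projected measure has an atom at almost every point. The atom has mass at
  least \<open>\<beta> ^ m\<close>, and \<open>m\<close> has finite mean, which bounds the entropy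
  at all scales at once.\<close>

lemma scale_entropy_bounded_if_degenerate:
  assumes pos: "\<forall>i r s. A i $ r $ s > 0"
    and deg: "AE a in bernoulli p. \<exists>n. dual (prefix a n) = 0"
    and w: "emeasure (bernoulli p) (cyl w) \<noteq> 0"
  shows "\<exists>K\<ge>0. \<forall>r>0. scale_entropy r (proj_meas T u (cond_cyl (bernoulli p) w)) \<le> K"
proof -
  interpret M: prob_space "bernoulli p" by (rule prob_space_bernoulli)
  interpret prob_space "cond_cyl (bernoulli p) w"
    unfolding cond_cyl_eq using w by (intro prob_space_uniform_measure) auto
  have sets_c [simp, measurable_cong]: "sets (cond_cyl (bernoulli p) w) = sets (bernoulli p)"
    and space_c [simp]: "space (cond_cyl (bernoulli p) w) = UNIV"
    by (simp_all add: cond_cyl_eq)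
  have F_meas: "F \<in> borel_measurable (cond_cyl (bernoulli p) w)"
    using F_measurable by (simp cong: measurable_cong_sets)
  have eig: "\<exists>l. transpose (A i) *v perp u = l *\<^sub>R perp u" if "i \<in> set_pmf p" for i
    using eigenvector_if_degenerate[OF pos deg that] .
  have AE_hit: "AE a in bernoulli p. (\<forall>j. a j \<in> set_pmf p) \<and> a (hit a) \<in> kernel"
    using deg AE_bernoulli_set_pmf
  proof eventually_elim
    case (elim a)
    then obtain n where n: "dual (prefix a n) = 0" by blast
    have sub: "set (prefix a n) \<subseteq> set_pmf p" using elim by (auto simp: prefix_def)
    obtain l where "dual (prefix a n) = l *\<^sub>R perp u" "l = 0 \<longleftrightarrow> set (prefix a n) \<inter> kernel \<noteq> {}"
      using dual_degenerate[OF eig sub] by blast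
    moreover have "perp u \<noteq> 0" using norm_perp by auto
    ultimately have "set (prefix a n) \<inter> kernel \<noteq> {}" using n by simp
    then have "\<exists>j. a j \<in> kernel" by (auto simp: prefix_def)
    then have "a (hit a) \<in> kernel" unfolding hit_def by (rule LeastI_ex)
    with elim show ?case by blast
  qed
  have kernel: "set_pmf p \<inter> kernel \<noteq> {}"
  proof
    assume "set_pmf p \<inter> kernel = {}"
    have "AE a in bernoulli p. False"
      using AE_hit
    proof eventually_elim
      case (elim a)
      then show False using \<open>set_pmf p \<inter> kernel = {}\<close> by blast
    qed
    then show False by simp
  qed
  define \<beta> where "\<beta> = Min (pmf p ` set_pmf p)"
  have \<beta>: "0 < \<beta>" "\<beta> \<le> 1" "\<And>i. i \<in> set_pmf p \<Longrightarrow> \<beta> \<le> pmf p i"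
  proof -
    show "0 < \<beta>" unfolding \<beta>_def using set_pmf_not_empty[of p]
      by (subst Min_gr_iff) (auto simp: pmf_positive)
    show le: "\<beta> \<le> pmf p i" if "i \<in> set_pmf p" for i
      unfolding \<beta>_def using that by (intro Min_le) auto
    obtain i where "i \<in> set_pmf p" using set_pmf_not_empty[of p] by blast
    from order_trans[OF le[OF this] pmf_le_1] show "\<beta> \<le> 1" .
  qed
  \<comment> \<open>\<open>hit b + 1\<close> letters include the collapsing one, since indices start
    at 0; adding \<open>length w\<close> places the cylinder inside \<open>cyl w\<close>.\<close>
  define g where "g b = real (hit b + 1 + length w) * (- ln \<beta>)" for b
  have g0: "0 \<le> g b" for b using \<beta> unfolding g_def by (intro mult_nonneg_nonneg) auto
  have int_hit: "integrable (cond_cyl (bernoulli p) w) (\<lambda>b. real (hit b))"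
  proof (rule integrableI_nonneg)
    have "(\<integral>\<^sup>+b. ennreal (real (hit b)) \<partial>cond_cyl (bernoulli p) w)
        = (\<integral>\<^sup>+b. of_nat (hit b) * indicator (cyl w) b \<partial>bernoulli p) / emeasure (bernoulli p) (cyl w)"
      unfolding cond_cyl_eq by (simp add: nn_integral_uniform_measure ennreal_of_nat_eq_real_of_nat)
    also have "\<dots> \<le> (\<integral>\<^sup>+b. of_nat (hit b) \<partial>bernoulli p) / emeasure (bernoulli p) (cyl w)"
      by (intro divide_right_mono_ennreal nn_integral_mono) (auto split: split_indicator)
    also have "\<dots> < \<infinity>"
      using nn_integral_hit_finite[OF kernel] w
      by (simp add: less_top[symmetric] ennreal_divide_eq_top_iff)
    finally show "(\<integral>\<^sup>+b. ennreal (real (hit b)) \<partial>cond_cyl (bernoulli p) w) < \<infinity>" .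
  qed auto
  then have int_g: "integrable (cond_cyl (bernoulli p) w) g"
    unfolding g_def[abs_def] by simp
  have "scale_entropy r (proj_meas T u (cond_cyl (bernoulli p) w)) \<le> expectation g" if r: "0 < r" for r
    unfolding proj_meas_eq
  proof (rule scale_entropy_le_integral[OF F_meas int_g])
    have "AE b in cond_cyl (bernoulli p) w. (\<forall>j. b j \<in> set_pmf p) \<and> b (hit b) \<in> kernel \<and> b \<in> cyl w"
      unfolding cond_cyl_eq
    proof (rule AE_uniform_measureI[OF cyl_sets])
      show "AE b in bernoulli p. b \<in> cyl w \<longrightarrow>
          (\<forall>j. b j \<in> set_pmf p) \<and> b (hit b) \<in> kernel \<and> b \<in> cyl w"
        using AE_hit by eventually_elim blast
    qed
    then show "AE b in cond_cyl (bernoulli p) w. 0 \<le> g b \<and>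
        - ln (prob {c \<in> space (cond_cyl (bernoulli p) w). F c \<in> ball (F b) r}) \<le> g b"
    proof eventually_elim
      case (elim b)
      define m where "m = hit b + 1 + length w"
      have b: "prefix b (length w) = w" using elim by (simp add: cyl_iff)
      have sub: "set (prefix b m) \<subseteq> set_pmf p" using elim by (auto simp: prefix_def)
      have "b (hit b) \<in> set (prefix b m)"
        unfolding prefix_def set_map set_upt by (intro imageI) (simp add: m_def)
      then have "set (prefix b m) \<inter> kernel \<noteq> {}" using elim by blast
      then have dual: "dual (prefix b m) = 0"
        using dual_degenerate[OF eig sub] by auto
      have cyl_w: "cyl (prefix b m) \<subseteq> cyl w"
      proof
        fix c assume "c \<in> cyl (prefix b m)"
        then have "prefix c m = prefix b m" by (simp add: cyl_iff)
        from prefix_eq_le[OF this, of "length w"] show "c \<in> cyl w" by (simp add: cyl_iff b m_def)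
      qed
      have cyl_F: "F c = F b" if "c \<in> cyl (prefix b m)" for c
      proof -
        have "prefix c m = prefix b m" using that by (simp add: cyl_iff)
        then show ?thesis using F_near[of c m] F_near[of b m] dual by simp
      qed
      have "\<beta> ^ m \<le> (\<Prod>j<m. pmf p (b j))"
        using prod_mono[of "{..<m}" "\<lambda>_. \<beta>" "\<lambda>j. pmf p (b j)"] \<beta> elim by simp
      also have "\<dots> = M.prob (cyl (prefix b m))"
        using emeasure_cyl[of p "prefix b m"] by (simp add: M.emeasure_eq_measure prod_nonneg)
      also have "\<dots> \<le> M.prob (cyl (prefix b m)) / M.prob (cyl w)"
      proof -
        have "0 < M.prob (cyl w)" using w by (simp add: M.emeasure_eq_measure zero_less_measure_iff)
        then show ?thesis using mult_left_mono[OF M.prob_le_1[of "cyl w"], of "M.prob (cyl (prefix b m))"]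
          by (simp add: field_simps)
      qed
      also have "\<dots> = prob (cyl (prefix b m))"
        unfolding cond_cyl_eq using w cyl_w
        by (subst measure_uniform_measure) (auto simp: Int_absorb1 M.emeasure_eq_measure)
      also have "\<dots> \<le> prob {c \<in> space (cond_cyl (bernoulli p) w). F c \<in> ball (F b) r}"
      proof (rule finite_measure_mono)
        show "cyl (prefix b m) \<subseteq> {c \<in> space (cond_cyl (bernoulli p) w). F c \<in> ball (F b) r}"
          using cyl_F r by auto
        show "{c \<in> space (cond_cyl (bernoulli p) w). F c \<in> ball (F b) r} \<in> events"
          using F_meas unfolding mem_ball by measurable
      qed
      finally have le: "\<beta> ^ m \<le> prob {c \<in> space (cond_cyl (bernoulli p) w). F c \<in> ball (F b) r}" .
      have "0 < \<beta> ^ m" using \<beta> by simp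
      then have "ln (\<beta> ^ m) \<le> ln (prob {c \<in> space (cond_cyl (bernoulli p) w). F c \<in> ball (F b) r})"
        using le by (subst ln_le_cancel_iff) auto
      moreover have "g b = - ln (\<beta> ^ m)"
        unfolding g_def m_def[symmetric] using \<beta> by (simp only: ln_realpow mult_minus_right)
      ultimately show ?case using g0[of b] by linarith
    qed
  qed
  moreover have "0 \<le> expectation g" using g0 by (intro integral_nonneg_AE) auto
  ultimately show ?thesis by blast
qed

text \<open>For large \<open>N\<close> every index \<open>nj\<close> is the same number, so all
  terms are entropies of one fixed conditioned measure and share a bound \<open>K\<close>. After
  normalisation the average is at most \<open>K / (N * ln 2)\<close>, which tends to 0.\<close>

lemma nonpos_if_degenerate:
  assumes pos: "\<forall>i r s. A i $ r $ s > 0"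
    and deg: "AE a in bernoulli p. \<exists>n. dual (prefix a n) = 0"
    and hyp: "AE a in bernoulli p. \<exists>L.
       ((\<lambda>N. liminf (\<lambda>n. ereal (1 / (real N * ln 2) * (1 / real n) *
          (\<Sum>i=1..n. word_entropy N i (prefix a (nj T u a N i)))))) \<longlongrightarrow> L) sequentially \<and> L \<ge> ereal C"
  shows "C \<le> 0"
proof -
  interpret prob_space "bernoulli p" by (rule prob_space_bernoulli)
  have "AE a in bernoulli p. C \<le> 0"
    using deg hyp AE_bernoulli_set_pmf
  proof eventually_elim
    case (elim a)
    \<comment> \<open>Once the projection has collapsed, \<open>wlen\<close> takes the junk value \<open>- log 2 0 = 0\<close>; the predicate
      defining \<open>nj\<close> then becomes unsatisfiable and \<open>nj\<close> is an unspecified constant.\<close>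
    define stuck where "stuck = (LEAST n :: nat. False)"
    obtain m where m: "dual (prefix a m) = 0" using elim by blast
    \<comment> \<open>The inserted 0 covers the value of \<open>wlen\<close> after the collapse and
      keeps the maximum defined for \<open>m = 0\<close>.\<close>
    define B where "B = Max (insert 0 ((\<lambda>n. wlen T u (prefix a n)) ` {..<m}))"
    have B: "wlen T u (prefix a n) \<le> B" for n
    proof (cases "n < m")
      case True
      then show ?thesis unfolding B_def by (intro Max_ge) auto
    next
      case False
      then have "wlen T u (prefix a n) = 0"
        using dual_prefix_le[OF m, of n] by (simp add: wlen_eq log_def)
      also have "0 \<le> B" unfolding B_def by (intro Max_ge) auto
      finally show ?thesis .
    qed
    have nj: "nj T u a N i = stuck" if "B < real N" "1 \<le> i" for N i
    proof -
      have "real N * 1 \<le> real N * real i" using that by (intro mult_left_mono) auto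
      then have "\<not> real (N * i) \<le> wlen T u (prefix a n)" for n
        using B[of n] that by simp
      then show ?thesis unfolding nj_def stuck_def by (simp only:)
    qed
    have "0 < (\<Prod>j<length (prefix a stuck). pmf p (prefix a stuck ! j))"
      using elim by (intro prod_pos) (simp add: pmf_positive)
    then have "emeasure (bernoulli p) (cyl (prefix a stuck)) \<noteq> 0"
      unfolding emeasure_cyl ennreal_eq_0_iff not_le .
    from scale_entropy_bounded_if_degenerate[OF pos deg this] obtain K where K: "0 \<le> K"
      "\<And>r. 0 < r \<Longrightarrow> scale_entropy r (proj_meas T u (cond_cyl (bernoulli p) (prefix a stuck))) \<le> K"
      by blast
    obtain L where L: "((\<lambda>N. liminf (\<lambda>n. ereal (1 / (real N * ln 2) * (1 / real n) *
          (\<Sum>i=1..n. word_entropy N i (prefix a (nj T u a N i)))))) \<longlongrightarrow> L) sequentially"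
      and "ereal C \<le> L" using elim by blast
    have "\<forall>\<^sub>F N in sequentially. liminf (\<lambda>n. ereal (1 / (real N * ln 2) * (1 / real n) *
          (\<Sum>i=1..n. word_entropy N i (prefix a (nj T u a N i))))) \<le> ereal (K / ln 2 * (1 / real N))"
      using filterlim_at_top_dense[THEN iffD1, rule_format, OF filterlim_real_sequentially, of B]
        eventually_gt_at_top[of 0]
    proof eventually_elim
      case (elim N)
      have "ereal (1 / (real N * ln 2) * (1 / real n) *
          (\<Sum>i=1..n. word_entropy N i (prefix a (nj T u a N i)))) \<le> ereal (K / ln 2 * (1 / real N))" for n
      proof -
        have "(\<Sum>i=1..n. word_entropy N i (prefix a (nj T u a N i))) \<le> (\<Sum>i=1..n. K)"
        proof (rule sum_mono)
          fix i assume "i \<in> {1..n}"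
          then have "nj T u a N i = stuck" using elim by (intro nj) auto
          then show "word_entropy N i (prefix a (nj T u a N i)) \<le> K"
            unfolding word_entropy_def using K(2) by simp
        qed
        then have "1 / (real N * ln 2) * (1 / real n) * (\<Sum>i=1..n. word_entropy N i (prefix a (nj T u a N i)))
            \<le> 1 / (real N * ln 2) * (1 / real n) * (real n * K)"
          by (intro mult_left_mono) auto
        also have "\<dots> \<le> K / ln 2 * (1 / real N)"
          using K(1) elim by (cases "n = 0") (auto simp: field_simps)
        finally show ?thesis by simp
      qed
      then have "liminf (\<lambda>n. ereal (1 / (real N * ln 2) * (1 / real n) *
          (\<Sum>i=1..n. word_entropy N i (prefix a (nj T u a N i))))) \<le> liminf (\<lambda>n. ereal (K / ln 2 * (1 / real N)))"
        by (intro Liminf_mono always_eventually) auto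
      then show ?case by (simp add: Liminf_const)
    qed
    moreover have "(\<lambda>N. ereal (K / ln 2 * (1 / real N))) \<longlonglongrightarrow> ereal (K / ln 2 * 0)"
      by (intro tendsto_intros lim_1_over_n)
    ultimately have "L \<le> ereal (K / ln 2 * 0)"
      using L by (intro tendsto_le[OF sequentially_bot]) auto
    from order_trans[OF \<open>ereal C \<le> L\<close> this] have "ereal C \<le> ereal 0" by simp
    then show ?case by simp
  qed
  then show ?thesis by simp
qed

end

theorem theorem4p3:
  fixes A :: "'a::finite \<Rightarrow> real^2^2" and d :: "'a \<Rightarrow> real^2"
    and p :: "'a pmf" and u :: "real^2" and C :: real
  assumes pos: "\<forall>i r s. A i $ r $ s > 0"
    and contr: "\<forall>i. onorm (\<lambda>x. A i *v x) < 1"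
    and inv: "\<forall>i. (\<lambda>x. A i *v x + d i) ` cball 0 1 \<subseteq> cball 0 1"
    and theta: "norm u = 1"
    and hyp: "AE a in bernoulli p. \<exists>L.
       ((\<lambda>N. liminf (\<lambda>n. ereal (1 / (real N * ln 2) * (1 / real n) *
          (\<Sum>i=1..n. scale_entropy (2 powr (- ((real i + 1) * real N)))
             (proj_meas (\<lambda>i x. A i *v x + d i) u
               (cond_cyl (bernoulli p)
                 (prefix a (nj (\<lambda>i x. A i *v x + d i) u a N i))))))))
         \<longlongrightarrow> L) sequentially \<and> L \<ge> ereal C"
  shows "hausdorff_dim_measure (proj_meas (\<lambda>i x. A i *v x + d i) u (bernoulli p)) \<ge> C"
proof -
  interpret ifs_projection A d p u
    by unfold_locales (use contr inv theta in auto)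
  have T: "(\<lambda>i x. A i *v x + d i) = T" by (simp add: fun_eq_iff T_def)
  note hyp' = hyp[unfolded T, folded word_entropy_def]
  show ?thesis
  proof (cases "AE a in bernoulli p. \<exists>n. dual (prefix a n) = 0")
    case True
    from nonpos_if_degenerate[OF pos True hyp'] have "C \<le> 0" .
    also have "0 \<le> hausdorff_dim_measure (proj_meas T u (bernoulli p))"
      by (intro hausdorff_dim_measure_ge hausdorff_dim_nonneg)
    finally show ?thesis unfolding T .
  next
    case False
    from dim_ge_if_nondegenerate[OF False hyp'] show ?thesis unfolding T .
  qed
qed

end
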